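(* Let $K$ be a field of characteristic zero. If $f$ and $g$ are polynomials in $K[z]$ of degrees $n$ and $m$, respectively, for which $K[f,g]=K[z]$, then $n$ divides $m$ or $m$ divides $n$.
   Context: $K[z]$ is the polynomial ring in one variable $z$ over $K$, and $K[f,g]$ denotes the $K$-subalgebra of $K[z]$ generated by $f$ and $g$. *)

theory Defs
  imports "HOL-Computational_Algebra.Computational_Algebra"
begin

definition is_subalgebra :: "'a::field poly set \<Rightarrow> bool"
  where "is_subalgebra A \<longleftrightarrow>
    1 \<in> A \<and>
    (\<forall>p\<in>A. \<forall>q\<in>A. p + q \<in> A) \<and>
    (\<forall>p\<in>A. \<forall>q\<in>A. p * q \<in> A) \<and>
    (\<forall>c. \<forall>p\<in>A. smult c p \<in> A)"

definition subalgebra_gen :: "'a::field poly set \<Rightarrow> 'a poly set"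
  where "subalgebra_gen S = is_subalgebra hull S"

lemma is_subalgebra_subalgebra_gen: "is_subalgebra (subalgebra_gen S)"
  unfolding subalgebra_gen_def by (rule hull_in) (auto simp: is_subalgebra_def)

lemma subset_subalgebra_gen: "S \<subseteq> subalgebra_gen S"
  unfolding subalgebra_gen_def by (rule hull_subset)

lemma subalgebra_gen_minimal: "S \<subseteq> A \<Longrightarrow> is_subalgebra A \<Longrightarrow> subalgebra_gen S \<subseteq> A"
  unfolding subalgebra_gen_def by (rule hull_minimal)

end

theory Submission
  imports Defs "Jordan_Normal_Form.Char_Poly"
begin

text \<open>
  Let n = deg f and m = deg g; by symmetry one may take 0 < n \<le> m, and the aim is then that n divides m.
  Write x for an indeterminate that is sent to f, let F = K(x) and E = K(z), and let v be the
  degree on E. A polynomial h over F is given the value v(h(g)), its coefficients being read in K(f).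
  Values of nonzero elements of K(f) are multiples of n. Moreover g is a root of a monic P of
  degree n over K[x] (\<open>integral_equation\<close>), and as K[f,g] = K[z], the powers 1, g, ..., g^(n-1) are a
  basis of E over K(f).

  The heart of the proof is a family of monic polynomials Q_0, ..., Q_(n-1) over K[x], with Q_j of
  degree j, whose values are pairwise distinct modulo n (\<open>separating_exists\<close>). Once they are there,
  no cancellation of leading terms is possible in a K[f]-combination of the Q_j(g). Every power z^d with
  d < n is such a combination, so for the unique j with v(Q_j) = d modulo n one gets v(Q_j) \<le> d. All
  values are therefore less than n. In particular Q_1 = Y + b(x) gives deg(g + b(f)) < n \<le> deg g, so
  deg g is the degree of b(f), a multiple of n.

  Over the field F such a family exists in every characteristic, by MacLane's key polynomials. Call a
  divisor N of n a level if all nonzero polynomials of degree less than N have values divisible by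
  D = n/N. If N < n, counting dimensions yields a monic p of degree N whose value is not divisible by D
  (\<open>key_exists\<close>). The expansions in powers of p then show that N * r is again a level, where r is the
  order of v(p) modulo D (\<open>level_next\<close>). The Q_j are products of powers of the key polynomials.

  Characteristic zero is what makes it possible to choose the key polynomials over K[x]. Let p be a key
  polynomial of degree N and give the expansion of a polynomial in powers of p the weight in which p
  counts v(p). Then P has weight D * v(p) (\<open>w_le_min_poly\<close>), as if P were homogeneous in p. The
  Tschirnhausen transformation p \<mapsto> p + c/D, where c is the coefficient of p^(D-1) in P, therefore
  changes p by a term of value at most v(p); this value is divisible by D while v(p) is not, so p + c/D is
  again a key polynomial with the same value. Iterating it leads to the approximate D-th root of P, the
  only monic q of degree N with deg(P - q^D) < n - N. The same iteration started at Y^N never leaves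
  K[x][Y], so by uniqueness this q has coefficients in K[x] (\<open>key_over_B\<close>).
\<close>

hide_const (open) Module.smult

section \<open>Valuations\<close>

locale valued_field =
  fixes v :: "'e::field \<Rightarrow> int"
  assumes v_mult: "a \<noteq> 0 \<Longrightarrow> b \<noteq> 0 \<Longrightarrow> v (a * b) = v a + v b"
    and v_add: "a \<noteq> 0 \<Longrightarrow> b \<noteq> 0 \<Longrightarrow> a + b \<noteq> 0 \<Longrightarrow> v (a + b) \<le> max (v a) (v b)"
begin

text \<open>The function v says nothing about 0, whose value should be minus infinity; so 0 satisfies every
  upper bound.\<close>

definition v_le :: "'e \<Rightarrow> int \<Rightarrow> bool"
  where "v_le e c \<longleftrightarrow> e = 0 \<or> v e \<le> c"

lemma v_le_0 [simp]: "v_le 0 c"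
  by (simp add: v_le_def)

lemma v_le_self: "v_le e (v e)"
  by (simp add: v_le_def)

lemma v_le_mono: "v_le e c \<Longrightarrow> c \<le> d \<Longrightarrow> v_le e d"
  by (auto simp: v_le_def)

lemma v_le_add: "v_le a c \<Longrightarrow> v_le b c \<Longrightarrow> v_le (a + b) c"
  using v_add[of a b] by (cases "a + b = 0"; cases "a = 0"; cases "b = 0") (auto simp: v_le_def)

lemma v_le_mult: "v_le a c \<Longrightarrow> v_le b d \<Longrightarrow> v_le (a * b) (c + d)"
  using v_mult[of a b] by (cases "a = 0"; cases "b = 0") (auto simp: v_le_def)

lemma v_one: "v 1 = 0"
  using v_mult[of 1 1] by simp

lemma v_uminus: "v (- a) = v a"
proof (cases "a = 0")
  case False
  have "v (-1) = 0" using v_mult[of "-1" "-1"] v_one by simp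
  then show ?thesis using v_mult[of "-1" a] False by simp
qed simp

lemma v_le_uminus: "v_le a c \<Longrightarrow> v_le (- a) c"
  by (simp add: v_le_def v_uminus)

lemma v_le_diff: "v_le a c \<Longrightarrow> v_le b c \<Longrightarrow> v_le (a - b) c"
  using v_le_add[OF _ v_le_uminus, of a c b] by simp

lemma v_power: "a \<noteq> 0 \<Longrightarrow> v (a ^ k) = int k * v a"
  by (induction k) (simp_all add: v_one v_mult algebra_simps)

lemma v_add_dominant:
  assumes "a \<noteq> 0" "b = 0 \<or> v b < v a"
  shows "a + b \<noteq> 0" "v (a + b) = v a"
proof -
  show nz: "a + b \<noteq> 0"
    using assms v_uminus[of a] by (metis add.inverse_unique less_irrefl neg_0_equal_iff_equal)
  have "v_le (a + b) (v a)"
    using v_le_add[of a "v a" b] assms by (auto simp: v_le_def)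
  moreover have "v_le a (max (v (a + b)) (v b))" if "b \<noteq> 0"
    using v_le_diff[of "a + b" "max (v (a + b)) (v b)" b] by (simp add: v_le_def)
  ultimately show "v (a + b) = v a"
    using assms nz by (cases "b = 0") (auto simp: v_le_def)
qed

lemma v_le_add_distinct:
  assumes "v_le (a + b) c" "a \<noteq> 0 \<Longrightarrow> b \<noteq> 0 \<Longrightarrow> v a \<noteq> v b"
  shows "v_le a c" "v_le b c"
proof -
  have "v_le a c \<and> v_le b c"
  proof (cases "a = 0 \<or> b = 0")
    case False
    then consider "v b < v a" | "v a < v b" using assms(2) by linarith
    then show ?thesis
    proof cases
      case 1
      then show ?thesis using v_add_dominant[of a b] False assms(1) by (auto simp: v_le_def)
    next
      case 2
      then show ?thesis using v_add_dominant[of b a] False assms(1)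
        by (auto simp: v_le_def add.commute)
    qed
  qed (use assms in auto)
  then show "v_le a c" "v_le b c" by auto
qed

text \<open>Terms with distinct values cannot cancel their leading parts, so the largest value survives in the
  sum. Zero terms are allowed, since expansions may have gaps.\<close>

lemma v_sum_distinct:
  assumes "finite I" "\<exists>i\<in>I. e i \<noteq> 0"
    and "\<And>i j. i \<in> I \<Longrightarrow> j \<in> I \<Longrightarrow> i \<noteq> j \<Longrightarrow> e i \<noteq> 0 \<Longrightarrow> e j \<noteq> 0 \<Longrightarrow> v (e i) \<noteq> v (e j)"
  shows "sum e I \<noteq> 0 \<and> (\<exists>i\<in>I. e i \<noteq> 0 \<and> v (sum e I) = v (e i)) \<and> (\<forall>i\<in>I. v_le (e i) (v (sum e I)))"
  using assms
proof (induction I rule: finite_induct)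
  case (insert x I)
  consider "\<forall>i\<in>I. e i = 0" | "e x = 0" "\<exists>i\<in>I. e i \<noteq> 0" | "e x \<noteq> 0" "\<exists>i\<in>I. e i \<noteq> 0"
    by blast
  then show ?case
  proof cases
    case 1
    then have "sum e (insert x I) = e x" using insert.hyps by simp
    with 1 insert.prems(1) show ?thesis by (auto simp: v_le_def)
  next
    case 2
    then have "sum e (insert x I) = sum e I" using insert.hyps by simp
    with 2 insert.IH insert.prems(2) show ?thesis by auto
  next
    case 3
    have IH: "sum e I \<noteq> 0" "\<exists>i\<in>I. e i \<noteq> 0 \<and> v (sum e I) = v (e i)"
      "\<forall>i\<in>I. v_le (e i) (v (sum e I))"
      using insert.IH 3 insert.prems(2) by auto
    have ne: "v (e x) \<noteq> v (sum e I)"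
      using IH(2) insert.prems(2)[of x] insert.hyps 3 by force
    have eq: "sum e (insert x I) = e x + sum e I" using insert.hyps by simp
    show ?thesis
    proof (cases "v (e x) < v (sum e I)")
      case True
      from v_add_dominant[of "sum e I" "e x"] True IH(1)
      have "sum e (insert x I) \<noteq> 0" "v (sum e (insert x I)) = v (sum e I)"
        unfolding eq by (simp_all add: add.commute)
      with IH True show ?thesis by (auto simp: v_le_def)
    next
      case False
      from v_add_dominant[of "e x" "sum e I"] False ne 3
      have "sum e (insert x I) \<noteq> 0" "v (sum e (insert x I)) = v (e x)"
        unfolding eq by simp_all
      with IH False 3 show ?thesis by (fastforce simp: v_le_def)
    qed
  qed
qed simp

corollary v_le_sum_distinct:
  assumes "finite I" "v_le (sum e I) c" "i \<in> I"
    and "\<And>i j. i \<in> I \<Longrightarrow> j \<in> I \<Longrightarrow> i \<noteq> j \<Longrightarrow> e i \<noteq> 0 \<Longrightarrow> e j \<noteq> 0 \<Longrightarrow> v (e i) \<noteq> v (e j)"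
  shows "v_le (e i) c"
  using v_sum_distinct[of I e] assms unfolding v_le_def by fastforce

end

section \<open>Approximate roots of monic polynomials\<close>

lemma monic_power_degree:
  fixes A :: "'a::idom poly"
  assumes "lead_coeff A = 1"
  shows "lead_coeff (A ^ k) = 1" "degree (A ^ k) = k * degree A"
proof -
  have "A \<noteq> 0" using assms by auto
  then show "degree (A ^ k) = k * degree A" by (simp add: degree_power_eq mult.commute)
  have "lead_coeff (A ^ k) = lead_coeff A ^ k" by (rule lead_coeff_power)
  then show "lead_coeff (A ^ k) = 1" unfolding assms by simp
qed

lemma degree_mod_monic_less:
  fixes q :: "'a::field poly"
  shows "degree q > 0 \<Longrightarrow> degree (h mod q) < degree q"
  by (metis degree_0 degree_mod_less less_irrefl)

lemma degree_diff_same_lead_coeff: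
  fixes A B :: "'a::ab_group_add poly"
  assumes "degree A = M" "degree B = M" "lead_coeff A = lead_coeff B" "0 < M"
  shows "degree (A - B) < M"
proof -
  have "coeff (A - B) M = 0" "degree (A - B) \<le> M"
    using assms by (auto intro: degree_diff_le)
  then have "degree (A - B) \<noteq> M"
    using assms(4) leading_coeff_0_iff[of "A - B"] by force
  with \<open>degree (A - B) \<le> M\<close> show ?thesis by simp
qed

lemma sum_power_products_close:
  fixes A B :: "'a::idom poly"
  assumes "lead_coeff A = 1" "lead_coeff B = 1" "degree A = N" "degree B = N" "0 < N" "2 \<le> D"
  shows "degree ((\<Sum>i<D. B ^ (D - Suc i) * A ^ i) - of_nat D * B ^ (D - 1)) < N * (D - 1)"
proof -
  have "(\<Sum>i<D. B ^ (D - Suc i) * A ^ i) - of_nat D * B ^ (D - 1)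
     = (\<Sum>i<D. B ^ (D - Suc i) * A ^ i - B ^ (D - 1))"
    by (simp add: sum_subtractf)
  moreover have "degree (B ^ (D - Suc i) * A ^ i - B ^ (D - 1)) < N * (D - 1)" if "i < D" for i
  proof (rule degree_diff_same_lead_coeff)
    have "degree (B ^ (D - Suc i) * A ^ i) = (D - Suc i) * N + i * N"
      using assms by (subst degree_mult_eq) (auto simp: monic_power_degree)
    also have "\<dots> = (D - Suc i + i) * N" by (simp only: add_mult_distrib)
    also have "\<dots> = N * (D - 1)" using that by simp
    finally show "degree (B ^ (D - Suc i) * A ^ i) = N * (D - 1)" .
    show "lead_coeff (B ^ (D - Suc i) * A ^ i) = lead_coeff (B ^ (D - 1))"
      using assms by (simp add: lead_coeff_mult lead_coeff_power)
    show "degree (B ^ (D - 1)) = N * (D - 1)"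
      using monic_power_degree(2)[OF assms(2), of "D - 1"] assms(4) by (simp only: mult.commute)
  qed (use assms in auto)
  ultimately show ?thesis
    using assms by (auto intro!: degree_sum_less)
qed

text \<open>In A^D - B^D = (A - B) S the cofactor S is a sum of D monic polynomials of degree N * (D - 1), so
  its leading coefficient is D, which must not vanish.\<close>

lemma approx_root_unique:
  fixes A B :: "'a::idom poly"
  assumes "lead_coeff A = 1" "lead_coeff B = 1" "degree A = N" "degree B = N" "0 < N" "2 \<le> D"
    and "of_nat D \<noteq> (0::'a)" and "degree (A ^ D - B ^ D) < N * (D - 1)"
  shows "A = B"
proof (rule ccontr)
  assume "A \<noteq> B"
  define S where "S = (\<Sum>i<D. B ^ (D - Suc i) * A ^ i)"
  have deg: "degree (B ^ (D - 1)) = N * (D - 1)" and lc: "lead_coeff (B ^ (D - 1)) = 1"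
    using monic_power_degree[OF assms(2), of "D - 1"] assms(4) by (simp_all only: mult.commute)
  have "coeff (S - of_nat D * B ^ (D - 1)) (N * (D - 1)) = 0"
    unfolding S_def by (rule coeff_eq_0[OF sum_power_products_close[OF assms(1-6)]])
  moreover have "coeff (of_nat D * B ^ (D - 1)) (N * (D - 1)) = of_nat D"
    using lc unfolding deg of_nat_poly by simp
  ultimately have "coeff S (N * (D - 1)) = of_nat D"
    by (metis coeff_diff eq_iff_diff_eq_0)
  with assms have "S \<noteq> 0" "N * (D - 1) \<le> degree S" by (auto intro!: le_degree)
  moreover have "A ^ D - B ^ D = (A - B) * S"
    unfolding S_def by (rule power_diff_sumr2)
  ultimately show False
    using assms(8) \<open>A \<noteq> B\<close> by (simp add: degree_mult_eq)
qed

text \<open>Here c is the coefficient of q^(D-1) in the expansion of P in powers of q. Replacing q by q + c/D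
  removes the leading part c q^(D-1) of P - q^D, and all further terms of (q + c/D)^D have a lower
  degree.\<close>

lemma tschirnhausen_step:
  fixes P q :: "'a::field poly"
  assumes q: "lead_coeff q = 1" "degree q = N" "0 < N" and P: "lead_coeff P = 1" "degree P = D * N"
    and D: "2 \<le> D" "of_nat D \<noteq> (0::'a)"
  defines "c \<equiv> P div q ^ (D - 1) - q"
  shows "degree c < N"
    and "\<not> degree (P - q ^ D) < N * (D - 1) \<Longrightarrow>
       degree (P - (q + smult (1 / of_nat D) c) ^ D) < degree (P - q ^ D)"
proof -
  define E where "E = P - q ^ D"
  define Q where "Q = q ^ (D - 1)"
  have Q: "degree Q = N * (D - 1)" "Q \<noteq> 0" "0 < degree Q" and qD: "q ^ D = q * Q"
    using q D by (auto simp: Q_def monic_power_degree simp flip: power_Suc)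
  have "c = E div Q"
    unfolding c_def E_def Q_def[symmetric] qD using Q by (simp add: poly_div_diff_left)
  then have E: "E = c * Q + E mod Q" by simp
  have degE: "degree E < D * N"
    unfolding E_def using q P D monic_power_degree[OF q(1), of D] by (intro degree_diff_same_lead_coeff) simp_all
  have modE: "degree (E mod Q) < degree Q" using Q by (intro degree_mod_monic_less)
  have cQ: "degree c + degree Q \<le> degree E" if "c \<noteq> 0"
  proof -
    have "degree (c * Q) = degree c + degree Q" using that Q by (simp add: degree_mult_eq)
    moreover from this have "degree (c * Q + E mod Q) = degree (c * Q)"
      using modE by (intro degree_add_eq_left) simp
    ultimately show ?thesis using E by simp
  qed
  have "N + degree Q = D * N" using Q D by (cases D) (auto simp: algebra_simps)
  then show c: "degree c < N" using cQ degE q by (cases "c = 0") auto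
  assume "\<not> degree (P - q ^ D) < N * (D - 1)"
  then have bigE: "degree Q \<le> degree E" using Q E_def by simp
  have "c \<noteq> 0" using E modE bigE by auto
  define s where "s = smult (1 / of_nat D) c"
  define A where "A = q + s"
  have s: "s \<noteq> 0" "degree s = degree c" "of_nat D * s = c"
    using \<open>c \<noteq> 0\<close> D by (simp_all add: s_def of_nat_poly)
  have A: "lead_coeff A = 1" "degree A = N"
    using q c s by (simp_all add: A_def degree_add_eq_left coeff_eq_0)
  define R where "R = (\<Sum>i<D. q ^ (D - Suc i) * A ^ i) - of_nat D * Q"
  have R: "degree R < degree Q"
    unfolding R_def Q_def[symmetric] using sum_power_products_close[OF A(1) q(1) A(2) q(2,3) D(1)] Q
    by (simp add: Q_def)
  have "A ^ D - q ^ D = s * (\<Sum>i<D. q ^ (D - Suc i) * A ^ i)"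
    using power_diff_sumr2[of A D q] by (simp add: A_def)
  also have "\<dots> = s * (of_nat D * Q + R)" by (simp add: R_def)
  also have "\<dots> = c * Q + s * R" using s(3) by (simp add: algebra_simps flip: mult.assoc)
  finally have "P - A ^ D = E mod Q - s * R"
    using E unfolding E_def by (simp add: algebra_simps)
  moreover have "degree (s * R) < degree E"
    using degree_mult_le[of s R] R s cQ[OF \<open>c \<noteq> 0\<close>] by linarith
  ultimately show "degree (P - (q + smult (1 / of_nat D) c) ^ D) < degree (P - q ^ D)"
    unfolding A_def[symmetric] s_def[symmetric] E_def[symmetric]
    using modE bigE degree_diff_less[of "E mod Q" "degree E" "s * R"]
    by simp
qed

text \<open>An invariant of the transformation passes to the approximate root. It is used for two different
  invariants, starting from two different polynomials, and the uniqueness of the approximate root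
  identifies the results.\<close>

lemma approx_root_iterate:
  fixes P q :: "'a::field poly"
  assumes P: "lead_coeff P = 1" "degree P = D * N" and D: "2 \<le> D" "of_nat D \<noteq> (0::'a)" and N: "0 < N"
    and monic: "\<And>q. \<Phi> q \<Longrightarrow> lead_coeff q = 1 \<and> degree q = N"
    and step: "\<And>q. \<Phi> q \<Longrightarrow> \<Phi> (q + smult (1 / of_nat D) (P div q ^ (D - 1) - q))"
    and "\<Phi> q"
  shows "\<exists>q. \<Phi> q \<and> degree (P - q ^ D) < N * (D - 1)"
  using \<open>\<Phi> q\<close>
proof (induction "degree (P - q ^ D)" arbitrary: q rule: less_induct)
  case less
  show ?case
  proof (cases "degree (P - q ^ D) < N * (D - 1)")
    case False
    have "degree (P - (q + smult (1 / of_nat D) (P div q ^ (D - 1) - q)) ^ D) < degree (P - q ^ D)"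
      using tschirnhausen_step(2)[OF _ _ N P D, of q] monic[OF less.prems] False by blast
    from less.hyps[OF this step[OF less.prems]] show ?thesis .
  qed (use less.prems in blast)
qed

section \<open>Expansions in powers of a polynomial\<close>

lemma degree_div_monic:
  fixes p :: "'a::field poly"
  assumes "0 < degree p" "h div p \<noteq> 0"
  shows "degree (h div p) + degree p = degree h"
proof -
  have "p \<noteq> 0" using assms by auto
  then have "degree (h div p * p) = degree (h div p) + degree p"
    using assms by (simp add: degree_mult_eq)
  moreover have "degree (h div p * p + h mod p) = degree (h div p * p)"
    using degree_mod_monic_less[OF assms(1), of h] calculation by (intro degree_add_eq_left) simp
  ultimately show ?thesis by simp
qed

lemma adic_expansion:
  fixes p :: "'a::field poly"
  assumes "degree h < m * degree p"
  shows "h = (\<Sum>k<m. (h div p ^ k) mod p * p ^ k)"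
proof -
  have eq: "h = (\<Sum>k<m. (h div p ^ k) mod p * p ^ k) + h div p ^ m * p ^ m" for m
  proof (induction m)
    case (Suc m)
    have "h div p ^ m = h div p ^ Suc m * p + (h div p ^ m) mod p"
      by (simp add: power_Suc2 poly_div_mult_right del: power_Suc)
    then have step: "h div p ^ m * p ^ m = h div p ^ Suc m * p ^ Suc m + (h div p ^ m) mod p * p ^ m"
      by (metis (no_types, opaque_lifting) distrib_right mult.assoc power_Suc)
    have "h = (\<Sum>k<m. (h div p ^ k) mod p * p ^ k) + h div p ^ m * p ^ m" by (rule Suc)
    also have "\<dots> = (\<Sum>k<Suc m. (h div p ^ k) mod p * p ^ k) + h div p ^ Suc m * p ^ Suc m"
      unfolding step by (simp only: sum.lessThan_Suc ac_simps)
    finally show ?case .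
  qed simp
  have "p \<noteq> 0" using assms by auto
  then have "h div p ^ m = 0"
    using assms by (intro div_poly_less) (simp add: degree_power_eq mult.commute)
  then have "(\<Sum>k<m. (h div p ^ k) mod p * p ^ k) + h div p ^ m * p ^ m
      = (\<Sum>k<m. (h div p ^ k) mod p * p ^ k)" by simp
  with eq[of m] show ?thesis by (rule trans)
qed

section \<open>Polynomials over a subring\<close>

definition poly_over :: "'a::comm_ring_1 set \<Rightarrow> 'a poly \<Rightarrow> bool"
  where "poly_over B h \<longleftrightarrow> (\<forall>i. coeff h i \<in> B)"

locale subring_of =
  fixes B :: "'f::field set"
  assumes B_1: "1 \<in> B" and B_diff: "a \<in> B \<Longrightarrow> b \<in> B \<Longrightarrow> a - b \<in> B"
    and B_mult: "a \<in> B \<Longrightarrow> b \<in> B \<Longrightarrow> a * b \<in> B"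
begin

lemma B_0: "0 \<in> B"
  using B_diff[OF B_1 B_1] by simp

lemma B_add: "a \<in> B \<Longrightarrow> b \<in> B \<Longrightarrow> a + b \<in> B"
  using B_diff[OF _ B_diff[OF B_0], of a b] by simp

lemma B_sum: "(\<And>i. i \<in> I \<Longrightarrow> x i \<in> B) \<Longrightarrow> sum x I \<in> B"
  by (induction I rule: infinite_finite_induct) (auto intro: B_0 B_add)

lemma poly_over_0: "poly_over B 0"
  by (simp add: poly_over_def B_0)

lemma poly_over_monom: "a \<in> B \<Longrightarrow> poly_over B (monom a k)"
  by (simp add: poly_over_def B_0)

lemma poly_over_1: "poly_over B 1"
  using poly_over_monom[OF B_1, of 0] by simp

lemma poly_over_add: "poly_over B g \<Longrightarrow> poly_over B h \<Longrightarrow> poly_over B (g + h)"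
  by (simp add: poly_over_def B_add)

lemma poly_over_diff: "poly_over B g \<Longrightarrow> poly_over B h \<Longrightarrow> poly_over B (g - h)"
  by (simp add: poly_over_def B_diff)

lemma poly_over_smult: "a \<in> B \<Longrightarrow> poly_over B h \<Longrightarrow> poly_over B (smult a h)"
  by (simp add: poly_over_def B_mult)

lemma poly_over_mult: "poly_over B g \<Longrightarrow> poly_over B h \<Longrightarrow> poly_over B (g * h)"
  by (simp add: poly_over_def coeff_mult B_mult B_sum)

lemma poly_over_power: "poly_over B g \<Longrightarrow> poly_over B (g ^ k)"
  by (induction k) (simp_all add: poly_over_1 poly_over_mult)

lemma poly_over_div_mod:
  assumes "poly_over B q" "lead_coeff q = 1" "0 < degree q" "poly_over B h"
  shows "poly_over B (h div q) \<and> poly_over B (h mod q)"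
  using assms(4)
proof (induction "degree h" arbitrary: h rule: less_induct)
  case less
  show ?case
  proof (cases "degree h < degree q")
    case True
    then show ?thesis using less.prems by (simp add: div_poly_less mod_poly_less poly_over_0)
  next
    case False
    define t where "t = monom (lead_coeff h) (degree h - degree q)"
    define h' where "h' = h - t * q"
    have t: "poly_over B t"
      using less.prems by (auto simp: t_def poly_over_def B_0)
    then have h': "poly_over B h'"
      using less.prems assms by (simp add: h'_def poly_over_diff poly_over_mult)
    have "lead_coeff h \<noteq> 0" using False assms by auto
    then have "t \<noteq> 0" "q \<noteq> 0" "degree t = degree h - degree q" "lead_coeff t = lead_coeff h"
      using assms by (auto simp: t_def degree_monom_eq)
    then have "degree (t * q) = degree h" using False by (simp add: degree_mult_eq)
    moreover have "lead_coeff (t * q) = lead_coeff h"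
      unfolding lead_coeff_mult assms(2) \<open>lead_coeff t = lead_coeff h\<close> by simp
    ultimately have "degree h' < degree h"
      unfolding h'_def using False assms by (intro degree_diff_same_lead_coeff) auto
    from less.hyps[OF this h'] have IH: "poly_over B (h' div q)" "poly_over B (h' mod q)" by auto
    have h: "h = h' + t * q" by (simp add: h'_def)
    have "q \<noteq> 0" using assms by auto
    then have "h div q = h' div q + t" "h mod q = h' mod q"
      unfolding h by (simp_all add: poly_div_add_left)
    with IH t show ?thesis by (simp add: poly_over_add)
  qed
qed

end

section \<open>Levels and key polynomials\<close>

text \<open>An extension that is generated by y and, with the same degree n, by an element z of value 1, while the
  values of the base field are multiples of n: a totally ramified extension of degree n. The
  condition on z is what guarantees that every residue modulo n is a value.\<close>

locale valued_extension = field_hom \<phi> + valued_field v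
  for \<phi> :: "'f::field \<Rightarrow> 'e::field" and v :: "'e \<Rightarrow> int" +
  fixes n :: nat and z y :: 'e
  assumes n_pos: "0 < n"
    and v_base: "a \<noteq> 0 \<Longrightarrow> int n dvd v (\<phi> a)"
    and z_nz: "z \<noteq> 0" and v_z: "v z = 1"
    and y_span: "\<exists>c. y ^ j = (\<Sum>k<n. \<phi> (c k) * z ^ k)"
    and z_span: "\<exists>c. z ^ k = (\<Sum>j<n. \<phi> (c j) * y ^ j)"
begin

definition ev :: "'f poly \<Rightarrow> 'e"
  where "ev h = poly (map_poly \<phi> h) y"

sublocale mp: map_poly_idom_hom \<phi> ..

lemma ev_0 [simp]: "ev 0 = 0" and ev_1 [simp]: "ev 1 = 1"
  and ev_add: "ev (g + h) = ev g + ev h" and ev_diff: "ev (g - h) = ev g - ev h"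
  and ev_mult: "ev (g * h) = ev g * ev h" and ev_power: "ev (g ^ k) = ev g ^ k"
  and ev_smult: "ev (smult a h) = \<phi> a * ev h" and ev_monom: "ev (monom a k) = \<phi> a * y ^ k"
  by (simp_all add: ev_def hom_distribs poly_monom)

lemma ev_sum: "ev (sum h I) = (\<Sum>i\<in>I. ev (h i))"
  by (induction I rule: infinite_finite_induct) (simp_all add: ev_add)

lemma ev_conv_sum: "degree h < m \<Longrightarrow> ev h = (\<Sum>j<m. \<phi> (coeff h j) * y ^ j)"
  using poly_as_sum_of_monoms'[of h "m - 1"]
  by (cases m) (simp_all add: lessThan_Suc_atMost flip: ev_monom ev_sum)

text \<open>Linear dependence for families instead of sets, so that repeated vectors cause no trouble.\<close>

lemma relation_exists:
  assumes "finite I" "finite J" "card J < card I"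
    and span: "\<And>i. i \<in> I \<Longrightarrow> \<exists>c. x i = (\<Sum>j\<in>J. \<phi> (c j) * w j)"
  shows "\<exists>c. (\<exists>i\<in>I. c i \<noteq> 0) \<and> (\<Sum>i\<in>I. \<phi> (c i) * x i) = 0"
proof (cases "inj_on x I")
  case False
  then obtain i j where ij: "i \<in> I" "j \<in> I" "i \<noteq> j" "x i = x j"
    by (auto simp: inj_on_def)
  define c :: "_ \<Rightarrow> 'f" where "c = (\<lambda>k. if k = i then 1 else if k = j then -1 else 0)"
  have "(\<Sum>k\<in>I. \<phi> (c k) * x k) = (\<Sum>k\<in>{i, j}. \<phi> (c k) * x k)"
    using ij assms(1) by (intro sum.mono_neutral_right) (auto simp: c_def)
  also have "\<dots> = 0"
    using ij by (simp add: c_def hom_distribs)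
  finally show ?thesis using ij by (intro exI[of _ c] conjI bexI[of _ i]) (auto simp: c_def)
next
  case True
  interpret V: vector_space "\<lambda>c e. \<phi> c * e"
    by unfold_locales (simp_all add: hom_distribs algebra_simps)
  have "x ` I \<subseteq> V.span (w ` J)"
  proof (rule image_subsetI)
    fix i assume "i \<in> I"
    then obtain c where "x i = (\<Sum>j\<in>J. \<phi> (c j) * w j)" using span by blast
    then show "x i \<in> V.span (w ` J)"
      by (simp add: V.span_sum V.span_scale V.span_base)
  qed
  moreover have "card (w ` J) < card (x ` I)"
    using assms(2,3) True by (metis card_image card_image_le le_less_trans)
  ultimately have "V.dependent (x ` I)"
    using V.independent_span_bound[of "w ` J" "x ` I"] assms(2) by fastforce
  then obtain u where "\<exists>e\<in>x ` I. u e \<noteq> 0" "(\<Sum>e\<in>x ` I. \<phi> (u e) * e) = 0"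
    using V.dependent_finite[of "x ` I"] assms(1) by auto
  then show ?thesis
    using True by (intro exI[of _ "\<lambda>i. u (x i)"]) (auto simp: sum.reindex)
qed

lemma z_combination:
  assumes "K \<subseteq> {..<n}" "\<exists>k\<in>K. c k \<noteq> 0"
  shows "(\<Sum>k\<in>K. \<phi> (c k) * z ^ k) \<noteq> 0 \<and>
    (\<exists>k\<in>K. v (\<Sum>k\<in>K. \<phi> (c k) * z ^ k) mod int n = int k)"
proof -
  have vk: "v (\<phi> (c k) * z ^ k) mod int n = int k" if k: "k \<in> K" "c k \<noteq> 0" for k
  proof -
    obtain t where "v (\<phi> (c k)) = int n * t" using v_base[OF k(2)] by (elim dvdE)
    moreover have "v (\<phi> (c k) * z ^ k) = v (\<phi> (c k)) + int k"
      using k(2) z_nz v_z by (simp add: v_mult v_power)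
    ultimately show ?thesis using k(1) assms(1) by auto
  qed
  have "(\<Sum>k\<in>K. \<phi> (c k) * z ^ k) \<noteq> 0 \<and>
      (\<exists>k\<in>K. \<phi> (c k) * z ^ k \<noteq> 0 \<and> v (\<Sum>k\<in>K. \<phi> (c k) * z ^ k) = v (\<phi> (c k) * z ^ k)) \<and>
      (\<forall>k\<in>K. v_le (\<phi> (c k) * z ^ k) (v (\<Sum>k\<in>K. \<phi> (c k) * z ^ k)))"
  proof (rule v_sum_distinct)
    show "v (\<phi> (c i) * z ^ i) \<noteq> v (\<phi> (c j) * z ^ j)"
      if "i \<in> K" "j \<in> K" "i \<noteq> j" "\<phi> (c i) * z ^ i \<noteq> 0" "\<phi> (c j) * z ^ j \<noteq> 0" for i j
      using vk[of i] vk[of j] that by auto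
  qed (use assms z_nz finite_subset[OF assms(1)] in auto)
  then obtain k where "k \<in> K" "\<phi> (c k) * z ^ k \<noteq> 0"
      "v (\<Sum>k\<in>K. \<phi> (c k) * z ^ k) = v (\<phi> (c k) * z ^ k)" "(\<Sum>k\<in>K. \<phi> (c k) * z ^ k) \<noteq> 0"
    by blast
  moreover from this have "c k \<noteq> 0" by auto
  ultimately show ?thesis using vk[of k] by auto
qed

text \<open>A relation of degree d < n would make y^d superfluous among the n generators y^j, while the n powers
  of z are independent.\<close>

lemma ev_nz:
  assumes "h \<noteq> 0" "degree h < n"
  shows "ev h \<noteq> 0"
proof
  assume ev: "ev h = 0"
  define d where "d = degree h"
  have "\<exists>c. (\<exists>i\<in>{..<n}. c i \<noteq> 0) \<and> (\<Sum>i<n. \<phi> (c i) * z ^ i) = 0"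
  proof (rule relation_exists[where J = "{..<n} - {d}" and w = "\<lambda>j. y ^ j"])
    show "card ({..<n} - {d}) < card {..<n}"
      using assms by (intro psubset_card_mono) (auto simp: d_def)
  next
    fix i
    obtain c where c: "z ^ i = (\<Sum>j<n. \<phi> (c j) * y ^ j)" using z_span by blast
    \<comment> \<open>subtract the multiple of the relation that removes the term with y^d\<close>
    define c' where "c' j = c j - c d / lead_coeff h * coeff h j" for j
    have "c' d = 0" using assms by (simp add: c'_def d_def)
    have "(\<Sum>j\<in>{..<n} - {d}. \<phi> (c' j) * y ^ j) = (\<Sum>j<n. \<phi> (c' j) * y ^ j)"
      using \<open>c' d = 0\<close> by (intro sum.mono_neutral_left) auto
    also have "\<dots> = z ^ i - \<phi> (c d / lead_coeff h) * ev h"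
      unfolding c ev_conv_sum[OF assms(2)] c'_def
      by (simp only: hom_distribs left_diff_distrib sum_subtractf sum_distrib_left mult.assoc)
    finally show "\<exists>c. z ^ i = (\<Sum>j\<in>{..<n} - {d}. \<phi> (c j) * y ^ j)"
      using ev by (intro exI[of _ c']) simp
  qed auto
  then show False using z_combination[of "{..<n}"] by blast
qed

text \<open>The values of polynomials of degree less than N then fill the subgroup of order N of the residues
  modulo n.\<close>

definition level :: "nat \<Rightarrow> bool"
  where "level N \<longleftrightarrow> 0 < N \<and> N dvd n \<and>
    (\<forall>h. h \<noteq> 0 \<longrightarrow> degree h < N \<longrightarrow> int (n div N) dvd v (ev h))"

lemma level_1: "level 1"
proof -
  have "int n dvd v (ev h)" if h: "h \<noteq> 0" "degree h < 1" for h
  proof -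
    obtain a where "h = monom a 0" using h(2) by (metis degree_eq_zeroE less_one monom_0)
    with h(1) show ?thesis using v_base[of a] by (simp add: ev_monom)
  qed
  then show ?thesis by (simp add: level_def)
qed

text \<open>MacLane's key polynomials: the first degree at which the value group grows, reached by a polynomial
  of best possible value.\<close>

definition key :: "'f poly \<Rightarrow> bool"
  where "key p \<longleftrightarrow> lead_coeff p = 1 \<and> level (degree p) \<and> degree p < n \<and>
    \<not> int (n div degree p) dvd v (ev p)"

text \<open>The N + 1 powers y^0, ..., y^N and the n - N powers z^k with k not divisible by D are too many to be
  independent. A relation equates some h(y), deg h \<le> N, with a combination of those z^k, whose value is
  not divisible by D. This replaces an infinite process of successive approximation, for
  which the base field would have to be complete.\<close>

lemma key_exists:
  assumes N: "level N" "N < n"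
  shows "\<exists>p. degree p = N \<and> key p"
proof (rule ccontr)
  assume none: "\<nexists>p. degree p = N \<and> key p"
  define D where "D = n div N"
  have D: "n = D * N" "0 < N" using N by (auto simp: D_def level_def)
  have dvd: "int D dvd v (ev h)" if h: "h \<noteq> 0" "degree h \<le> N" for h
  proof (cases "degree h = N")
    case True
    define p where "p = smult (1 / lead_coeff h) h"
    have lc: "coeff h N \<noteq> 0" using h True leading_coeff_0_iff[of h] by simp
    then have p: "degree p = N" "lead_coeff p = 1" using True by (simp_all add: p_def)
    then have "int D dvd v (ev p)" using none N by (auto simp: key_def D_def)
    moreover have "v (ev p) = v (\<phi> (1 / lead_coeff h)) + v (ev h)"
      using h True N lc ev_nz[of h] by (simp add: p_def ev_smult v_mult)
    moreover have "int D dvd v (\<phi> (1 / lead_coeff h))"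
      using dvd_trans[OF _ v_base, of "int D" "1 / lead_coeff h"] h D(1) by simp
    ultimately show ?thesis by (simp add: dvd_add_right_iff)
  qed (use N h in \<open>auto simp: level_def D_def\<close>)
  define K where "K = {k. k < n \<and> \<not> D dvd k}"
  define I where "I = {..N} <+> K"
  define x where "x = case_sum (\<lambda>j. y ^ j) (\<lambda>k. z ^ k)"
  have fK: "finite K" by (simp add: K_def)
  have "card K = n - N"
  proof -
    have "{k. k < n \<and> D dvd k} = (\<lambda>i. D * i) ` {..<N}"
      using D n_pos by (auto simp: mult.commute elim!: dvdE)
    moreover have "inj_on (\<lambda>i. D * i) {..<N}" using D n_pos by (auto simp: inj_on_def)
    ultimately have "card {k. k < n \<and> D dvd k} = N" by (simp add: card_image)
    moreover have "K = {..<n} - {k. k < n \<and> D dvd k}" by (auto simp: K_def)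
    ultimately show ?thesis by (simp add: card_Diff_subset subset_iff)
  qed
  then have "card I = n + 1" using N fK by (simp add: I_def card_Plus)
  have "\<exists>c. (\<exists>i\<in>I. c i \<noteq> 0) \<and> (\<Sum>i\<in>I. \<phi> (c i) * x i) = 0"
  proof (rule relation_exists[where J = "{..<n}" and w = "\<lambda>k. z ^ k"])
    show "\<exists>c. x i = (\<Sum>j<n. \<phi> (c j) * z ^ j)" if "i \<in> I" for i
    proof (cases i)
      case (Inl j)
      then show ?thesis using y_span by (simp add: x_def)
    next
      case (Inr k)
      then have "k < n" using that by (auto simp: I_def K_def)
      then have "z ^ k = (\<Sum>j\<in>{k}. \<phi> 1 * z ^ j)" by simp
      also have "\<dots> = (\<Sum>j<n. \<phi> (if j = k then 1 else 0) * z ^ j)"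
        using \<open>k < n\<close> by (intro sum.mono_neutral_cong_left) auto
      finally show ?thesis
        using Inr by (intro exI[of _ "\<lambda>j. if j = k then 1 else 0"]) (simp add: x_def)
    qed
  qed (use fK \<open>card I = n + 1\<close> in \<open>auto simp: I_def\<close>)
  then obtain c where c: "\<exists>i\<in>I. c i \<noteq> 0" "(\<Sum>i\<in>I. \<phi> (c i) * x i) = 0" by blast
  define h where "h = (\<Sum>j\<le>N. monom (c (Inl j)) j)"
  have hdeg: "degree h \<le> N"
    unfolding h_def by (rule degree_sum_le) (auto intro: order_trans[OF degree_monom_le])
  have hco: "coeff h j = c (Inl j)" if "j \<le> N" for j
    using that by (simp add: h_def coeff_sum coeff_monom if_distrib cong: if_cong)
  have "(\<Sum>i\<in>I. \<phi> (c i) * x i) = ev h + (\<Sum>k\<in>K. \<phi> (c (Inr k)) * z ^ k)"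
    unfolding I_def using fK by (subst sum.Plus) (simp_all add: x_def h_def ev_sum ev_monom)
  then have evh: "ev h = - (\<Sum>k\<in>K. \<phi> (c (Inr k)) * z ^ k)"
    using c(2) by (simp add: eq_neg_iff_add_eq_0)
  show False
  proof (cases "\<exists>k\<in>K. c (Inr k) \<noteq> 0")
    case True
    then obtain k where k: "k \<in> K" "v (ev h) mod int n = int k" "ev h \<noteq> 0"
      using z_combination[of K "\<lambda>k. c (Inr k)"] evh by (auto simp: v_uminus K_def)
    then have "int D dvd v (ev h)" using dvd[OF _ hdeg] by force
    then have "int D dvd int k" unfolding k(2)[symmetric] using D(1) by (simp add: dvd_mod_iff)
    then show False using k(1) by (simp add: K_def)
  next
    case False
    then have "ev h = 0" using evh by simp
    then have "h = 0" using ev_nz[of h] hdeg N by fastforce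
    then have "c (Inl j) = 0" if "j \<le> N" for j using hco[OF that] by simp
    with False c(1) show False by (auto simp: I_def)
  qed
qed

lemma keyD:
  assumes "key p"
  shows "lead_coeff p = 1" "p \<noteq> 0" "0 < degree p" "degree p < n" "n div degree p * degree p = n"
    "2 \<le> n div degree p" "ev p \<noteq> 0" "\<not> int (n div degree p) dvd v (ev p)"
proof -
  show *: "lead_coeff p = 1" "0 < degree p" "degree p < n"
    "\<not> int (n div degree p) dvd v (ev p)"
    using assms by (auto simp: key_def level_def)
  show n: "n div degree p * degree p = n"
    using assms unfolding key_def level_def by (intro dvd_div_mult_self) blast
  show "p \<noteq> 0" using * by auto
  then show "ev p \<noteq> 0" using * by (intro ev_nz)
  show "2 \<le> n div degree p"
  proof (rule ccontr)
    assume "\<not> 2 \<le> n div degree p"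
    then have "n div degree p = 0 \<or> n div degree p = 1" by linarith
    then have "n div degree p * degree p \<le> degree p" by auto
    with *(3) n show False by linarith
  qed
qed

lemma key_low:
  assumes "key p" "a \<noteq> 0" "degree a < degree p"
  shows "ev a \<noteq> 0" "int (n div degree p) dvd v (ev a)"
  using assms ev_nz[of a] by (auto simp: key_def level_def)

text \<open>The order of the value of p in the residues modulo D, where D is the index of the level: the factor
  by which p enlarges the value group.\<close>

definition ram :: "'f poly \<Rightarrow> nat"
  where "ram p = nat (int (n div degree p) div gcd (int (n div degree p)) (v (ev p)))"

lemma ram:
  assumes "key p"
  defines "D \<equiv> n div degree p"
  shows "int (ram p) * gcd (int D) (v (ev p)) = int D" "2 \<le> ram p"
    "int D dvd k * v (ev p) \<longleftrightarrow> int (ram p) dvd k"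
proof -
  define g where "g = gcd (int D) (v (ev p))"
  note key = keyD[OF assms(1), folded D_def]
  have g: "0 < g" using key(6) by (simp add: g_def)
  have "g dvd int D" by (simp add: g_def)
  then have "0 \<le> int D div g" using g by (simp add: pos_imp_zdiv_nonneg_iff)
  then have r: "int (ram p) = int D div g" by (simp add: ram_def D_def g_def)
  then show *: "int (ram p) * gcd (int D) (v (ev p)) = int D" by (simp add: g_def)
  have "ram p \<noteq> 0" using * key(6) by (intro notI) simp
  moreover have "ram p \<noteq> 1"
  proof
    assume "ram p = 1"
    then have "gcd (int D) (v (ev p)) = int D" using * by simp
    then show False using key(8) by (metis gcd_dvd2)
  qed
  ultimately show "2 \<le> ram p" by simp
  obtain d where d: "v (ev p) = g * d" unfolding g_def by (metis dvdE gcd_dvd2)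
  have D: "int D = g * int (ram p)" using * by (simp add: g_def mult.commute)
  have "coprime (int (ram p)) d"
  proof -
    have "gcd (int D) (v (ev p)) = g" by (simp add: g_def)
    then have "g * gcd (int (ram p)) d = g"
      unfolding D d using g gcd_mult_distrib_int[of g "int (ram p)" d] by simp
    then show ?thesis using g by (simp add: coprime_iff_gcd_eq_1)
  qed
  then show "int D dvd k * v (ev p) \<longleftrightarrow> int (ram p) dvd k"
    using g unfolding D d by (simp add: coprime_dvd_mult_left_iff mult.left_commute[of k])
qed

text \<open>The values of a and b are divisible by D, and the multiples i * v(p) with i < ram p are distinct
  modulo D.\<close>

lemma values_distinct:
  assumes "key p" "degree a < degree p" "degree b < degree p" "i < ram p" "j < ram p" "i \<noteq> j"
    and "ev a * ev p ^ i \<noteq> 0" "ev b * ev p ^ j \<noteq> 0"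
  shows "v (ev a * ev p ^ i) \<noteq> v (ev b * ev p ^ j)"
proof
  assume "v (ev a * ev p ^ i) = v (ev b * ev p ^ j)"
  then have "(int i - int j) * v (ev p) = v (ev b) - v (ev a)"
    using assms(7,8) keyD(7)[OF assms(1)] by (simp add: v_mult v_power algebra_simps)
  moreover have "a \<noteq> 0" "b \<noteq> 0" using assms(7,8) by auto
  then have "int (n div degree p) dvd v (ev b) - v (ev a)"
    using key_low(2)[OF assms(1)] assms(2,3) by (intro dvd_diff) auto
  ultimately have "int (n div degree p) dvd (int i - int j) * v (ev p)" by simp
  then have "int (ram p) dvd int i - int j" using ram(3)[OF assms(1)] by blast
  then show False using assms(4-6) zdvd_imp_le[of "int (ram p)" "\<bar>int i - int j\<bar>"] by auto
qed

lemma expansion_values: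
  assumes "key p" "degree h < ram p * degree p" "v_le (ev h) c" "k < ram p"
  shows "v_le (ev ((h div p ^ k) mod p) * ev p ^ k) c"
proof (rule v_le_sum_distinct[where I = "{..<ram p}"])
  have "ev h = (\<Sum>k<ram p. ev ((h div p ^ k) mod p) * ev p ^ k)"
    by (subst adic_expansion[OF assms(2)]) (simp only: ev_sum ev_mult ev_power)
  then show "v_le (\<Sum>k<ram p. ev ((h div p ^ k) mod p) * ev p ^ k) c" using assms(3) by simp
  fix i j
  assume "i \<in> {..<ram p}" "j \<in> {..<ram p}" "i \<noteq> j"
    "ev ((h div p ^ i) mod p) * ev p ^ i \<noteq> 0" "ev ((h div p ^ j) mod p) * ev p ^ j \<noteq> 0"
  then show "v (ev ((h div p ^ i) mod p) * ev p ^ i) \<noteq> v (ev ((h div p ^ j) mod p) * ev p ^ j)"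
    using degree_mod_monic_less[OF keyD(3)[OF assms(1)]]
    by (intro values_distinct[OF assms(1)]) auto
qed (use assms(4) in auto)

text \<open>A polynomial of degree less than ram p * deg p has the value of one term a p^k of its expansion, and
  this lies in the group generated by D and v(p).\<close>

lemma level_next:
  assumes "key p"
  shows "level (ram p * degree p)"
proof -
  define D where "D = n div degree p"
  define g where "g = gcd (int D) (v (ev p))"
  note key = keyD[OF assms, folded D_def] and ram = ram[OF assms, folded D_def]
  have g: "int D = int (ram p) * g" using ram(1) by (simp add: g_def)
  have "0 < g" using key(6) by (simp add: g_def)
  have n: "int n = int (ram p * degree p) * g" 
  proof -
    have "int n = int D * int (degree p)" using key(5) by (metis of_nat_mult)
    then show ?thesis by (simp add: g)
  qed
  then have gdiv: "int (n div (ram p * degree p)) = g"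
    using ram(2) key(3) by (simp add: zdiv_int)
  have "ram p * degree p dvd n" using n by (metis dvd_triv_left int_dvd_int_iff)
  moreover have "g dvd v (ev h)" if h: "h \<noteq> 0" "degree h < ram p * degree p" for h
  proof -
    have low: "degree ((h div p ^ k) mod p) < degree p" for k by (rule degree_mod_monic_less[OF key(3)])
    have evh: "ev h = (\<Sum>k<ram p. ev ((h div p ^ k) mod p) * ev p ^ k)"
      by (subst adic_expansion[OF h(2)]) (simp only: ev_sum ev_mult ev_power)
    have "\<exists>k<ram p. (h div p ^ k) mod p \<noteq> 0"
    proof (rule ccontr)
      assume "\<not> ?thesis"
      then have "(\<Sum>k<ram p. (h div p ^ k) mod p * p ^ k) = 0" by (intro sum.neutral) auto
      then show False using adic_expansion[OF h(2)] h(1) by argo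
    qed
    then have "\<exists>k\<in>{..<ram p}. ev ((h div p ^ k) mod p) * ev p ^ k \<noteq> 0"
      using key_low(1)[OF assms _ low] key(7) by auto
    then have "\<exists>k\<in>{..<ram p}. ev ((h div p ^ k) mod p) * ev p ^ k \<noteq> 0 \<and>
        v (ev h) = v (ev ((h div p ^ k) mod p) * ev p ^ k)"
      unfolding evh using v_sum_distinct[of "{..<ram p}" "\<lambda>k. ev ((h div p ^ k) mod p) * ev p ^ k"]
        values_distinct[OF assms low low] by auto
    then obtain k where k: "ev ((h div p ^ k) mod p) * ev p ^ k \<noteq> 0"
        "v (ev h) = v (ev ((h div p ^ k) mod p) * ev p ^ k)"
      by blast
    then have "v (ev h) = v (ev ((h div p ^ k) mod p)) + int k * v (ev p)"
      using key(7) by (simp add: v_mult v_power)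
    moreover have "(h div p ^ k) mod p \<noteq> 0" using k(1) by (metis ev_0 mult_zero_left)
    then have "int D dvd v (ev ((h div p ^ k) mod p))"
      using key_low(2)[OF assms _ low] unfolding D_def by blast
    then have "g dvd v (ev ((h div p ^ k) mod p))" unfolding g_def by (metis dvd_trans gcd_dvd1)
    ultimately show ?thesis by (simp add: g_def)
  qed
  ultimately show ?thesis using key(3) ram(2) gdiv by (simp add: level_def)
qed

section \<open>The weight defined by a key polynomial\<close>

text \<open>\<open>w_le p c h\<close> bounds by c the weight of h, the maximum of v(a_k) + k * v(p) over the coefficients
  a_k of the expansion of h in powers of p. The inductive form makes closure properties provable by rule
  induction, without handling expansions; \<open>w_le_coeff\<close> recovers the coefficients.\<close>

inductive w_le :: "'f poly \<Rightarrow> int \<Rightarrow> 'f poly \<Rightarrow> bool" for p where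
  low: "degree a < degree p \<Longrightarrow> v_le (ev a) c \<Longrightarrow> w_le p c a"
| add: "w_le p c g \<Longrightarrow> w_le p c h \<Longrightarrow> w_le p c (g + h)"
| shift: "w_le p c h \<Longrightarrow> w_le p (c + v (ev p)) (p * h)"

lemma w_le_0: "0 < degree p \<Longrightarrow> w_le p c 0"
  by (intro w_le.low) simp_all

lemma w_le_sum:
  "0 < degree p \<Longrightarrow> (\<And>i. i \<in> I \<Longrightarrow> w_le p c (h i)) \<Longrightarrow> w_le p c (sum h I)"
  by (induction I rule: infinite_finite_induct) (auto intro: w_le_0 w_le.add)

lemma w_le_shift_power: "w_le p c h \<Longrightarrow> w_le p (c + int k * v (ev p)) (p ^ k * h)"
proof (induction k)
  case (Suc k)
  from w_le.shift[OF Suc.IH[OF Suc.prems]] show ?case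
    by (simp add: algebra_simps)
qed simp

lemma w_le_term:
  assumes "key p" "degree a < degree p" "v_le (ev a * ev p ^ k) c"
  shows "w_le p c (a * p ^ k)"
proof -
  have "v_le (ev a) (c - int k * v (ev p))"
    using assms(3) keyD(7)[OF assms(1)] by (cases "ev a = 0") (auto simp: v_le_def v_mult v_power)
  from w_le_shift_power[OF w_le.low[OF assms(2) this], of k] show ?thesis
    by (simp add: mult.commute)
qed

lemma w_le_coeff:
  assumes "w_le p c h" "0 < degree p"
  shows "v_le (ev ((h div p ^ k) mod p)) (c - int k * v (ev p))"
  using assms(1)
proof (induction arbitrary: k rule: w_le.induct)
  case (low a c)
  show ?case
  proof (cases k)
    case 0
    then show ?thesis using low by (simp add: mod_poly_less)
  next
    case (Suc j)
    then show ?thesis using low by (simp add: poly_div_mult_right div_poly_less)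
  qed
next
  case (add c g h)
  then show ?case by (simp add: poly_div_add_left poly_mod_add_left ev_add v_le_add)
next
  case (shift c h)
  have "p \<noteq> 0" using assms(2) by auto
  show ?case
  proof (cases k)
    case (Suc j)
    then have "p * h div p ^ k = h div p ^ j"
      using \<open>p \<noteq> 0\<close> by (simp add: poly_div_mult_right)
    then show ?thesis using shift.IH[of j] Suc by (simp add: algebra_simps)
  qed simp
qed

text \<open>The only place where a carry occurs: a b = u p + r. Since v(u) and v(r) are divisible by D and v(p)
  is not, u p and r have distinct values, so that neither exceeds the value of a b.\<close>

lemma w_le_mult_low_low:
  assumes p: "key p" and a: "degree a < degree p" "v_le (ev a) c" and b: "degree b < degree p" "v_le (ev b) d"
  shows "w_le p (c + d) (a * b)"
proof -
  define u r where "u = (a * b) div p" and "r = (a * b) mod p"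
  have ab: "a * b = u * p + r" by (simp add: u_def r_def)
  have r: "degree r < degree p" unfolding r_def by (rule degree_mod_monic_less[OF keyD(3)[OF p]])
  have u: "degree u < degree p"
    using degree_div_monic[OF keyD(3)[OF p], of "a * b"] degree_mult_le[of a b] a b keyD(3)[OF p]
    by (cases "u = 0") (auto simp: u_def)
  have "v_le (ev u * ev p + ev r) (c + d)"
    using v_le_mult[OF a(2) b(2)] by (metis ab ev_add ev_mult)
  moreover have "v (ev u * ev p) \<noteq> v (ev r)" if "ev u * ev p \<noteq> 0" "ev r \<noteq> 0"
  proof
    assume "v (ev u * ev p) = v (ev r)"
    then have "v (ev p) = v (ev r) - v (ev u)" using that by (simp add: v_mult)
    moreover have "int (n div degree p) dvd v (ev r) - v (ev u)"
    proof (rule dvd_diff)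
      have "r \<noteq> 0" "u \<noteq> 0" using that by auto
      then show "int (n div degree p) dvd v (ev r)" "int (n div degree p) dvd v (ev u)"
        using key_low(2)[OF p _ r] key_low(2)[OF p _ u] by blast+
    qed
    ultimately show False using keyD(8)[OF p] by simp
  qed
  ultimately have *: "v_le (ev u * ev p) (c + d)" "v_le (ev r) (c + d)"
    using v_le_add_distinct[of "ev u * ev p" "ev r" "c + d"] by blast+
  show ?thesis
    unfolding ab using w_le_term[OF p u, of 1] *(1) w_le.low[OF r *(2)] by (simp add: w_le.add)
qed

lemma w_le_mult_low:
  assumes p: "key p" and a: "degree a < degree p" "v_le (ev a) d" and h: "w_le p c h"
  shows "w_le p (d + c) (a * h)"
  using h
proof (induction rule: w_le.induct)
  case (low b c)
  then show ?case using w_le_mult_low_low[OF p a] by blast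
next
  case (add c g h)
  then show ?case by (simp add: distrib_left w_le.add)
next
  case (shift c h)
  from w_le.shift[OF shift.IH] show ?case by (simp add: ac_simps)
qed

lemma w_le_mult:
  assumes p: "key p" and g: "w_le p c g" and h: "w_le p d h"
  shows "w_le p (c + d) (g * h)"
  using g
proof (induction rule: w_le.induct)
  case (low a c)
  then show ?case using w_le_mult_low[OF p _ _ h] by blast
next
  case (add c g h)
  then show ?case by (simp add: distrib_right w_le.add)
next
  case (shift c g)
  from w_le.shift[OF shift.IH] show ?case by (simp add: ac_simps)
qed

lemma w_le_power:
  assumes "key p" "w_le p c h"
  shows "w_le p (int k * c) (h ^ k)"
proof (induction k)
  case 0
  show ?case using keyD(3)[OF assms(1)] by (intro w_le.low) (simp_all add: v_le_def v_one)
next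
  case (Suc k)
  from w_le_mult[OF assms Suc] show ?case by (simp add: algebra_simps)
qed

lemma w_le_self: "key p \<Longrightarrow> w_le p (v (ev p)) p"
  using w_le_term[of p 1 1 "v (ev p)"] keyD(3) by (simp add: v_le_self)

text \<open>The weight does not depend on the choice of the key polynomial of a given degree and value.\<close>

lemma w_le_change:
  assumes p: "key p" "key (p + s)" "degree (p + s) = degree p" "v (ev (p + s)) = v (ev p)"
    and s: "degree s < degree p" "v_le (ev s) (v (ev p))" and h: "w_le p c h"
  shows "w_le (p + s) c h"
  using h
proof (induction rule: w_le.induct)
  case (low a c)
  then show ?case using p by (intro w_le.low) auto
next
  case (add c g h)
  then show ?case by (simp add: w_le.add)
next
  case (shift c h)
  have minus: "w_le (p + s) (v (ev p) + c) (- s * h)"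
    using s p(3) shift.IH by (intro w_le_mult_low[OF p(2)]) (simp_all add: ev_diff[of 0, simplified] v_le_uminus)
  have "w_le (p + s) (v (ev p) + c) ((p + s) * h)"
    using w_le.shift[OF shift.IH] p(4) by (simp only: add.commute)
  from w_le.add[OF minus this] have "w_le (p + s) (v (ev p) + c) (- s * h + (p + s) * h)" .
  also have "- s * h + (p + s) * h = p * h" by (simp add: algebra_simps)
  finally show ?case by (simp only: add.commute)
qed

lemma w_le_small:
  assumes p: "key p" and h: "degree h < ram p * degree p" "v_le (ev h) c"
  shows "w_le p c h"
proof -
  have "w_le p c (\<Sum>k<ram p. (h div p ^ k) mod p * p ^ k)"
  proof (rule w_le_sum[OF keyD(3)[OF p]])
    fix k assume "k \<in> {..<ram p}"
    then show "w_le p c ((h div p ^ k) mod p * p ^ k)"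
      using expansion_values[OF p h, of k] keyD(3)[OF p]
      by (intro w_le_term[OF p]) (simp_all add: degree_mod_monic_less)
  qed
  then show ?thesis by (subst adic_expansion[OF h(1)])
qed

text \<open>The minimal polynomial behaves like a homogeneous polynomial in p. By induction from the top level
  downwards: the next key polynomial q equals p^r up to terms of weight at most r * v(p), and its value
  is at most r * v(p), since otherwise it would be the value of q - p^r, which is too divisible.
  Substituting this in the expansion of P in powers of q gives the claim. At the top, P takes the role
  of q.\<close>

lemma w_le_min_poly:
  assumes "key p" and P: "lead_coeff P = 1" "degree P = n" "ev P = 0"
  shows "w_le p (int (n div degree p) * v (ev p)) P"
  using assms(1)
proof (induction "n - degree p" arbitrary: p rule: less_induct)
  case less
  note p = less.prems and key = keyD[OF less.prems]
  define r where "r = ram p"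
  define M where "M = r * degree p"
  define c where "c = int r * v (ev p)"
  have r: "2 \<le> r" using ram(2)[OF p] by (simp add: r_def)
  have M: "0 < M" "degree p < M" using r key(3) by (simp_all add: M_def)
  have lev: "level M" using level_next[OF p] by (simp add: M_def r_def)
  then have Mn: "M \<le> n" "M dvd n" using n_pos by (auto simp: level_def dvd_imp_le)
  have pr: "lead_coeff (p ^ r) = 1" "degree (p ^ r) = M"
    using monic_power_degree[OF key(1)] by (simp_all add: M_def)
  have wpr: "w_le p c (p ^ r)" using w_le_power[OF p w_le_self[OF p]] by (simp add: c_def)
  have vpr: "v (ev (p ^ r)) = c" "ev (p ^ r) \<noteq> 0" using key(7) by (simp_all add: ev_power v_power c_def)
  have low: "w_le p d h" if "degree h < M" "v_le (ev h) d" for h d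
    using w_le_small[OF p] that by (simp add: M_def r_def)
  have diff: "degree (g - p ^ r) < M" if "lead_coeff g = 1" "degree g = M" for g
    using that pr M by (intro degree_diff_same_lead_coeff) auto
  show ?case
  proof (cases "M = n")
    case True
    have "v_le (ev (P - p ^ r)) c" using vpr P by (simp add: ev_diff v_le_def v_uminus)
    then have "w_le p c (P - p ^ r)" using diff[of P] P True by (intro low) auto
    from w_le.add[OF this wpr] have "w_le p c P" by simp
    moreover have "n div degree p = r" unfolding True[symmetric] M_def using key(3) by simp
    ultimately show ?thesis by (simp add: c_def)
  next
    case False
    then have "M < n" using Mn by simp
    then obtain q where q: "degree q = M" "key q" using key_exists[OF lev] by blast
    note kq = keyD[OF q(2), unfolded q(1)]
    define D where "D = n div M"
    have Dr: "n div degree p = D * r"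
    proof -
      have "n = D * r * degree p" using kq(5) by (simp add: D_def M_def mult.assoc)
      then show ?thesis using key(3) by simp
    qed
    have gq: "degree (q - p ^ r) < M" using diff kq(1) q(1) by simp
    have Ddvd: "int D dvd v (ev (q - p ^ r))" if "q \<noteq> p ^ r"
      using key_low(2)[OF q(2), of "q - p ^ r"] that gq q(1) by (simp add: D_def)
    have Dc: "int D dvd c"
    proof -
      have "int (ram p) * gcd (int (n div degree p)) (v (ev p)) = int (ram p) * int D"
        using ram(1)[OF p] Dr by (simp add: r_def)
      then have "gcd (int (n div degree p)) (v (ev p)) = int D" using r by (simp add: r_def)
      then have "int D dvd v (ev p)" by (metis gcd_dvd2)
      then show ?thesis by (simp add: c_def)
    qed
    have vq: "v (ev q) \<le> c"
    proof (rule ccontr)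
      assume "\<not> v (ev q) \<le> c"
      then have dom: "ev q + - ev (p ^ r) \<noteq> 0" "v (ev q + - ev (p ^ r)) = v (ev q)"
        using v_add_dominant[of "ev q" "- ev (p ^ r)"] kq(7) vpr by (simp_all add: v_uminus)
      then have "q \<noteq> p ^ r" by auto
      then show False using Ddvd dom kq(8) by (simp add: ev_diff D_def)
    qed
    then have vR: "v_le (ev (q - p ^ r)) c"
      unfolding ev_diff using vpr by (intro v_le_diff) (simp_all add: v_le_def)
    have "w_le p c q" using w_le.add[OF low[OF gq vR] wpr] by simp
    have IH: "w_le q (int D * v (ev q)) P"
      using less.hyps[of q] q M \<open>M < n\<close> by (simp add: D_def)
    \<comment> \<open>D + 1 terms, the last of which is q^D, as P has degree D * M\<close>
    have P_eq: "P = (\<Sum>k<Suc D. (P div q ^ k) mod q * q ^ k)"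
      using q(1) P(2) kq(5) M(1) by (intro adic_expansion) (simp add: D_def)
    have "w_le p (int D * c) ((P div q ^ k) mod q * q ^ k)" if "k \<le> D" for k
    proof -
      have "int D * v (ev q) - int k * v (ev q) \<le> int (D - k) * c"
        using mult_left_mono[OF vq, of "int (D - k)"] that by (simp add: of_nat_diff left_diff_distrib)
      then have "v_le (ev ((P div q ^ k) mod q)) (int (D - k) * c)"
        using w_le_coeff[OF IH, of k] kq(3) q(1) v_le_mono by auto
      then have "w_le p (int (D - k) * c) ((P div q ^ k) mod q)"
        using degree_mod_monic_less[of q] q(1) kq(3) by (intro low) auto
      from w_le_mult[OF p this w_le_power[OF p \<open>w_le p c q\<close>, of k]]
      show ?thesis using that by (simp add: of_nat_diff algebra_simps)
    qed
    then have "w_le p (int D * c) P"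
      by (subst P_eq, intro w_le_sum[OF key(3)]) simp
    then show ?thesis by (simp add: Dr c_def mult.assoc)
  qed
qed

end

section \<open>Key polynomials with integral coefficients\<close>

text \<open>B plays the role of the polynomial ring K[x] inside K(x). That B contains the inverses of the positive
  integers and has no elements of negative value expresses characteristic zero of the residue
  field; it forces the integers to have value 0.\<close>

locale integral_extension = valued_extension \<phi> v n z y + subring_of B
  for \<phi> :: "'f::field \<Rightarrow> 'e::field" and v :: "'e \<Rightarrow> int" and n z y and B :: "'f set" +
  fixes P :: "'f poly"
  assumes char_0: "0 < k \<Longrightarrow> of_nat k \<noteq> (0::'f)"
    and B_inverse: "0 < k \<Longrightarrow> 1 / of_nat k \<in> B"
    and v_B: "a \<in> B \<Longrightarrow> a \<noteq> 0 \<Longrightarrow> 0 \<le> v (\<phi> a)"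
    and P: "poly_over B P" "lead_coeff P = 1" "degree P = n" "ev P = 0"
    and z_generated: "\<exists>W. poly_over B W \<and> ev W = z ^ k"
begin

lemma of_nat_in_B: "of_nat k \<in> B"
  by (induction k) (simp_all add: B_0 B_1 B_add)

lemma v_inverse_of_nat:
  assumes "0 < k"
  shows "v (\<phi> (1 / of_nat k)) = 0"
proof -
  have "v (\<phi> (of_nat k) * \<phi> (1 / of_nat k)) = v (\<phi> 1)"
    using char_0[OF assms] by (simp flip: hom_mult)
  then have "v (\<phi> (of_nat k)) + v (\<phi> (1 / of_nat k)) = 0"
    using char_0[OF assms] by (simp add: v_mult v_one del: hom_of_nat)
  moreover have "0 \<le> v (\<phi> (of_nat k))" "0 \<le> v (\<phi> (1 / of_nat k))"
    using v_B[OF of_nat_in_B, of k] v_B[OF B_inverse[OF assms]] char_0[OF assms]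
    by (simp_all del: hom_of_nat)
  ultimately show ?thesis by linarith
qed

text \<open>The correction s has value at most v(q) by the weight estimate, and in fact less, because its value
  is divisible by D and v(q) is not.\<close>

lemma tschirnhausen_key:
  assumes q: "key q" and D: "D = n div degree q" and w: "w_le q (int D * v (ev q)) P"
  defines "s \<equiv> smult (1 / of_nat D) (P div q ^ (D - 1) - q)"
  shows "key (q + s)" "degree (q + s) = degree q" "v (ev (q + s)) = v (ev q)"
    "w_le (q + s) (int D * v (ev q)) P"
proof -
  note key = keyD[OF q, folded D]
  define c where "c = P div q ^ (D - 1) - q"
  have s: "s = smult (1 / of_nat D) c" by (simp add: s_def c_def)
  have D0: "0 < D" using key(6) by simp
  have c: "degree c < degree q"
    unfolding c_def
    using tschirnhausen_step(1)[OF key(1) refl key(3) P(2) _ key(6) char_0[OF D0]] P(3) key(5) by simp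
  have "P div q ^ (D - 1) = q + c" by (simp add: c_def)
  then have "(P div q ^ (D - 1)) mod q = c"
    using c by (simp add: poly_mod_add_left mod_poly_less)
  then have "v_le (ev c) (int D * v (ev q) - int (D - 1) * v (ev q))"
    using w_le_coeff[OF w key(3), of "D - 1"] by simp
  moreover have "int D * v (ev q) - int (D - 1) * v (ev q) = v (ev q)"
    using D0 by (simp add: of_nat_diff algebra_simps)
  ultimately have vc: "v_le (ev c) (v (ev q))" by simp
  have degs: "degree s < degree q" using c by (simp add: s)
  \<comment> \<open>strictly smaller, as D divides one value and not the other\<close>
  have "s = 0 \<or> v (ev s) < v (ev q)"
  proof (cases "c = 0")
    case False
    have evc: "ev c \<noteq> 0" "int D dvd v (ev c)" using key_low[OF q False c] D by simp_all
    have "\<phi> (1 / of_nat D) \<noteq> 0" using char_0[OF D0] by (simp del: hom_of_nat)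
    then have "v (ev s) = v (ev c)"
      unfolding s ev_smult using evc v_inverse_of_nat[OF D0] by (subst v_mult) auto
    moreover have "v (ev c) \<noteq> v (ev q)" using evc(2) key(8) by auto
    ultimately show ?thesis using vc evc(1) by (auto simp: v_le_def)
  qed (simp add: s)
  then have small: "ev s = 0 \<or> v (ev s) < v (ev q)" by auto
  show v: "v (ev (q + s)) = v (ev q)"
    unfolding ev_add using v_add_dominant(2)[OF key(7) small] .
  show deg: "degree (q + s) = degree q" using degs by (rule degree_add_eq_left)
  have "lead_coeff (q + s) = 1" unfolding deg using degs key(1) by (simp add: coeff_eq_0)
  then show k: "key (q + s)"
    using q deg v by (simp add: key_def)
  show "w_le (q + s) (int D * v (ev q)) P"
    using small by (intro w_le_change[OF q k deg v degs _ w]) (auto simp: v_le_def)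
qed

lemma key_over_B:
  assumes "level N" "N < n"
  shows "\<exists>q. key q \<and> degree q = N \<and> poly_over B q"
proof -
  obtain p where p: "key p" "degree p = N" using key_exists[OF assms] by blast
  define D where "D = n div N"
  note key = keyD[OF p(1), unfolded p(2), folded D_def]
  have D: "of_nat D \<noteq> (0::'f)" using key(6) by (intro char_0) simp
  have degP: "degree P = D * N" using P(3) key(5) by simp
  define \<Phi> where "\<Phi> q \<longleftrightarrow> key q \<and> degree q = N \<and> w_le q (int D * v (ev q)) P" for q
  have "\<exists>q. \<Phi> q \<and> degree (P - q ^ D) < N * (D - 1)"
  proof (rule approx_root_iterate[OF P(2) degP key(6) D key(3)])
    show "lead_coeff q = 1 \<and> degree q = N" if "\<Phi> q" for q
      using that by (auto simp: \<Phi>_def key_def)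
    show "\<Phi> (q + smult (1 / of_nat D) (P div q ^ (D - 1) - q))" if "\<Phi> q" for q
      using that tschirnhausen_key[of q D] by (simp add: \<Phi>_def D_def)
    show "\<Phi> p" using p w_le_min_poly[OF p(1) P(2,3,4)] by (simp add: \<Phi>_def D_def)
  qed
  then obtain q where q: "\<Phi> q" "degree (P - q ^ D) < N * (D - 1)" by blast
  define \<Psi> where "\<Psi> q \<longleftrightarrow> poly_over B q \<and> lead_coeff q = 1 \<and> degree q = N" for q
  have "\<exists>q. \<Psi> q \<and> degree (P - q ^ D) < N * (D - 1)"
  proof (rule approx_root_iterate[OF P(2) degP key(6) D key(3)])
    show "lead_coeff q = 1 \<and> degree q = N" if "\<Psi> q" for q
      using that unfolding \<Psi>_def by blast
    show "\<Psi> (monom 1 N)" by (simp add: \<Psi>_def poly_over_monom B_1 degree_monom_eq)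
  next
    fix q assume "\<Psi> q"
    then have q: "poly_over B q" "lead_coeff q = 1" "degree q = N" by (auto simp: \<Psi>_def)
    define s where "s = smult (1 / of_nat D) (P div q ^ (D - 1) - q)"
    have "degree s < N"
      using tschirnhausen_step(1)[OF q(2,3) key(3) P(2) degP key(6) D] by (simp add: s_def)
    then have "degree (q + s) = N" "lead_coeff (q + s) = 1"
      using q by (simp_all add: degree_add_eq_left coeff_eq_0)
    moreover have "0 < degree (q ^ (D - 1))" "lead_coeff (q ^ (D - 1)) = 1"
      using monic_power_degree[OF q(2), of "D - 1"] q(3) key(3,6) by simp_all
    then have "poly_over B (P div q ^ (D - 1))"
      using poly_over_div_mod[OF poly_over_power[OF q(1)] _ _ P(1)] by blast
    then have "poly_over B (q + s)"
      unfolding s_def using key(6) q(1)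
      by (intro poly_over_add poly_over_smult poly_over_diff B_inverse) auto
    ultimately show "\<Psi> (q + smult (1 / of_nat D) (P div q ^ (D - 1) - q))"
      by (simp add: \<Psi>_def s_def)
  qed
  then obtain q' where q': "\<Psi> q'" "degree (P - q' ^ D) < N * (D - 1)" by blast
  have "degree (q ^ D - q' ^ D) < N * (D - 1)"
    using degree_diff_less[OF q'(2) q(2)] by simp
  then have "q = q'"
    using q q' key D by (intro approx_root_unique[where N = N and D = D]) (auto simp: \<Phi>_def \<Psi>_def key_def)
  then show ?thesis using q(1) q'(1) by (auto simp: \<Phi>_def \<Psi>_def)
qed

text \<open>A triangular system of polynomials over B in which no cancellation of leading terms is possible.\<close>

definition separating :: "nat \<Rightarrow> (nat \<Rightarrow> 'f poly) \<Rightarrow> bool"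
  where "separating N Q \<longleftrightarrow>
    (\<forall>j<N. poly_over B (Q j) \<and> lead_coeff (Q j) = 1 \<and> degree (Q j) = j) \<and>
    (\<forall>i<N. \<forall>j<N. v (ev (Q i)) mod int n = v (ev (Q j)) mod int n \<longrightarrow> i = j)"

text \<open>Mixed radix: the polynomial of degree a * N + b is q^a * Q_b for the key polynomial q of degree N.
  Modulo D the value determines a, and then the value of Q_b determines b.\<close>

lemma separating_extend:
  assumes lev: "level N" "N < n" and Q: "separating N Q"
  shows "\<exists>M Q'. N < M \<and> level M \<and> separating M Q'"
proof -
  obtain q where q: "key q" "degree q = N" "poly_over B q" using key_over_B[OF lev] by blast
  note key = keyD[OF q(1), unfolded q(2)]
  define D where "D = n div N"
  define M where "M = ram q * N"
  define Q' where "Q' j = q ^ (j div N) * Q (j mod N)" for j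
  have M: "N < M" using ram(2)[OF q(1)] key(3) by (simp add: M_def)
  have lo: "j mod N < N" for j using key(3) by simp
  have hi: "j div N < ram q" if "j < M" for j
    using that by (simp add: M_def less_mult_imp_div_less)
  have Qd: "poly_over B (Q b)" "lead_coeff (Q b) = 1" "degree (Q b) = b" "Q b \<noteq> 0"
    "int D dvd v (ev (Q b))" "ev (Q b) \<noteq> 0" if "b < N" for b
  proof -
    show *: "poly_over B (Q b)" "lead_coeff (Q b) = 1" "degree (Q b) = b"
      using Q that by (auto simp: separating_def)
    then show **: "Q b \<noteq> 0" by auto
    show "int D dvd v (ev (Q b))" "ev (Q b) \<noteq> 0"
      using key_low[OF q(1) **] * that q(2) by (simp_all add: D_def)
  qed
  have vQ': "v (ev (Q' j)) = int (j div N) * v (ev q) + v (ev (Q (j mod N)))" for j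
    using Qd(6)[OF lo] key(7) by (simp add: Q'_def ev_mult ev_power v_mult v_power)
  have "separating M Q'"
    unfolding separating_def
  proof (intro conjI allI impI)
    fix j assume "j < M"
    show "poly_over B (Q' j)"
      unfolding Q'_def by (intro poly_over_mult poly_over_power q(3) Qd(1) lo)
    show "lead_coeff (Q' j) = 1"
      unfolding Q'_def lead_coeff_mult monic_power_degree(1)[OF keyD(1)[OF q(1)]] Qd(2)[OF lo] by simp
    have "degree (Q' j) = degree (q ^ (j div N)) + degree (Q (j mod N))"
      unfolding Q'_def using Qd(4)[OF lo] key(2) by (intro degree_mult_eq) auto
    then show "degree (Q' j) = j"
      using monic_power_degree(2)[OF keyD(1)[OF q(1)], of "j div N"] Qd(3)[OF lo] q(2) by simp
  next
    fix i j assume ij: "i < M" "j < M" "v (ev (Q' i)) mod int n = v (ev (Q' j)) mod int n"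
    define a where "a = int (i div N) - int (j div N)"
    define b where "b = v (ev (Q (i mod N))) - v (ev (Q (j mod N)))"
    have n: "int n dvd a * v (ev q) + b"
    proof -
      have "int n dvd v (ev (Q' i)) - v (ev (Q' j))" using ij(3) by (simp add: mod_eq_dvd_iff)
      also have "v (ev (Q' i)) - v (ev (Q' j)) = a * v (ev q) + b"
        by (simp add: vQ' a_def b_def algebra_simps)
      finally show ?thesis .
    qed
    have "int D dvd int n" using key(5) by (metis D_def dvd_triv_left int_dvd_int_iff)
    then have "int D dvd a * v (ev q) + b" using n by (rule dvd_trans)
    moreover have "int D dvd b" unfolding b_def by (intro dvd_diff Qd(5) lo)
    ultimately have "int D dvd a * v (ev q)" by (simp add: dvd_add_left_iff)
    then have "int (ram q) dvd a" using ram(3)[OF q(1)] q(2) by (simp add: D_def)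
    moreover have "\<bar>a\<bar> < int (ram q)" using hi[OF ij(1)] hi[OF ij(2)] by (simp add: a_def)
    ultimately have "a = 0" using zdvd_imp_le[of "int (ram q)" "\<bar>a\<bar>"] by fastforce
    then have "v (ev (Q (i mod N))) mod int n = v (ev (Q (j mod N))) mod int n"
      using n by (simp add: b_def mod_eq_dvd_iff)
    then have "i mod N = j mod N" using Q lo by (simp add: separating_def)
    moreover have "i div N = j div N" using \<open>a = 0\<close> by (simp add: a_def)
    ultimately show "i = j" by (metis div_mult_mod_eq)
  qed
  moreover have "level M" using level_next[OF q(1)] q(2) by (simp add: M_def)
  ultimately show ?thesis using M by blast
qed

lemma separating_exists: "\<exists>Q. separating n Q"
proof -
  have "\<exists>Q. separating n Q" if "level N" "separating N Q" for N Q
    using that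
  proof (induction "n - N" arbitrary: N Q rule: less_induct)
    case less
    show ?case
    proof (cases "N < n")
      case True
      from separating_extend[OF less.prems(1) True less.prems(2)]
      obtain M Q' where M: "N < M" "level M" "separating M Q'" by blast
      then show ?thesis using less.hyps[of M Q'] True by simp
    next
      case False
      then have "N = n" using less.prems(1) n_pos by (auto simp: level_def dest: dvd_imp_le)
      then show ?thesis using less.prems(2) by blast
    qed
  qed
  moreover have "separating 1 (\<lambda>_. 1)"
    by (simp add: separating_def poly_over_1)
  ultimately show ?thesis using level_1 by blast
qed

lemma separating_expansion:
  assumes "separating n Q" "m \<le> n" "poly_over B W" "\<forall>i\<ge>m. coeff W i = 0"
  shows "\<exists>b. (\<forall>j. b j \<in> B) \<and> W = (\<Sum>j<m. smult (b j) (Q j))"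
  using assms(2-4)
proof (induction m arbitrary: W)
  case 0
  then have "W = 0" by (simp add: poly_eq_iff)
  then show ?case by (intro exI[of _ "\<lambda>_. 0"]) (simp add: B_0)
next
  case (Suc m)
  have Qm: "poly_over B (Q m)" "lead_coeff (Q m) = 1" "degree (Q m) = m"
    using assms(1) Suc.prems(1) unfolding separating_def by (auto simp only: Suc_le_eq)
  define a where "a = coeff W m"
  have a: "a \<in> B" using Suc.prems(2) by (simp add: a_def poly_over_def)
  have "coeff (W - smult a (Q m)) i = 0" if "m \<le> i" for i
  proof (cases "i = m")
    case True
    then show ?thesis using Qm by (simp add: a_def)
  next
    case False
    then show ?thesis using that Suc.prems(3) Qm(3) by (simp add: coeff_eq_0)
  qed
  then obtain b where b: "\<forall>j. b j \<in> B" "W - smult a (Q m) = (\<Sum>j<m. smult (b j) (Q j))"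
    using Suc.IH[of "W - smult a (Q m)"] Suc.prems(1,2) Qm(1) a
    by (auto simp: poly_over_diff poly_over_smult)
  have "(\<Sum>j<m. smult ((b(m := a)) j) (Q j)) = (\<Sum>j<m. smult (b j) (Q j))"
    by (intro sum.cong) auto
  then have "W = (\<Sum>j<Suc m. smult ((b(m := a)) j) (Q j))"
    using b(2) by (simp add: diff_eq_eq)
  then show ?case using b(1) a by (intro exI[of _ "b(m := a)"]) auto
qed

text \<open>The element z^d, with d the residue of the value e of Q_1, is a combination of the Q_j with
  coefficients of nonnegative value. Its value d is attained by one term, which by its residue belongs
  to Q_1, so e \<le> d < n.\<close>

lemma y_reduces_below_n:
  assumes "2 \<le> n"
  shows "\<exists>b\<in>B. v (y + \<phi> b) < int n"
proof -
  obtain Q where Q: "separating n Q" using separating_exists by blast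
  have Qd: "poly_over B (Q j)" "lead_coeff (Q j) = 1" "degree (Q j) = j" "ev (Q j) \<noteq> 0" if "j < n" for j
  proof -
    show *: "poly_over B (Q j)" "lead_coeff (Q j) = 1" "degree (Q j) = j"
      using Q that unfolding separating_def by blast+
    then have "Q j \<noteq> 0" by auto
    then show "ev (Q j) \<noteq> 0" using * that by (intro ev_nz) auto
  qed
  define e where "e = v (ev (Q 1))"
  define d where "d = nat (e mod int n)"
  have d: "int d = e mod int n" using n_pos by (simp add: d_def)
  obtain W where W: "poly_over B W" "ev W = z ^ d" using z_generated by blast
  define R where "R = W mod P"
  have "poly_over B R"
    unfolding R_def using poly_over_div_mod[OF P(1,2) _ W(1)] P(3) n_pos by simp
  moreover have "degree R < n"
    unfolding R_def using degree_mod_monic_less[of P W] P(3) n_pos by simp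
  then have "\<forall>i\<ge>n. coeff R i = 0" by (simp add: coeff_eq_0)
  ultimately obtain b where b: "\<And>j. b j \<in> B" "R = (\<Sum>j<n. smult (b j) (Q j))"
    using separating_expansion[OF Q order_refl] by blast
  have "ev W = ev (W div P * P + R)" by (simp add: R_def)
  also have "\<dots> = ev R" using P(4) by (simp add: ev_add ev_mult)
  finally have zR: "z ^ d = (\<Sum>j<n. \<phi> (b j) * ev (Q j))"
    unfolding W(2) b(2) by (simp add: ev_sum ev_smult)
  have vmod: "v (\<phi> (b j) * ev (Q j)) mod int n = v (ev (Q j)) mod int n"
    if "j < n" "\<phi> (b j) * ev (Q j) \<noteq> 0" for j
    using that v_base[of "b j"] by (auto simp: v_mult mod_eq_dvd_iff)
  have "(\<Sum>j<n. \<phi> (b j) * ev (Q j)) \<noteq> 0" unfolding zR[symmetric] using z_nz by simp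
  then have "\<exists>j\<in>{..<n}. \<phi> (b j) * ev (Q j) \<noteq> 0" by (rule contrapos_np) (simp add: sum.neutral)
  moreover have "v (\<phi> (b i) * ev (Q i)) \<noteq> v (\<phi> (b j) * ev (Q j))"
    if "i \<in> {..<n}" "j \<in> {..<n}" "i \<noteq> j" "\<phi> (b i) * ev (Q i) \<noteq> 0" "\<phi> (b j) * ev (Q j) \<noteq> 0" for i j
  proof
    assume "v (\<phi> (b i) * ev (Q i)) = v (\<phi> (b j) * ev (Q j))"
    then have "v (ev (Q i)) mod int n = v (ev (Q j)) mod int n"
      using vmod[of i] vmod[of j] that by simp
    then show False using Q that(1-3) unfolding separating_def by blast
  qed
  ultimately have "\<exists>i\<in>{..<n}. \<phi> (b i) * ev (Q i) \<noteq> 0 \<and> v (z ^ d) = v (\<phi> (b i) * ev (Q i))"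
    unfolding zR using v_sum_distinct[of "{..<n}" "\<lambda>j. \<phi> (b j) * ev (Q j)"] by blast
  then obtain i where i: "i < n" "\<phi> (b i) * ev (Q i) \<noteq> 0" "v (z ^ d) = v (\<phi> (b i) * ev (Q i))"
    by blast
  have vd: "v (z ^ d) = int d" using z_nz v_z by (simp add: v_power)
  then have "v (ev (Q i)) mod int n = e mod int n" using vmod[OF i(1,2)] i(3) d by simp
  moreover have "1 < n" using assms by simp
  ultimately have "i = 1" using Q i(1) unfolding separating_def e_def by blast
  then have "e \<le> int d"
    using i(2,3) vd v_B[OF b(1), of 1] by (simp add: v_mult e_def)
  moreover have "int d < int n" using d n_pos by simp
  ultimately have e: "e < int n" by simp
  have Q1: "Q 1 = [:coeff (Q 1) 0, 1:]"
  proof (rule poly_eqI)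
    show "coeff (Q 1) i = coeff [:coeff (Q 1) 0, 1:] i" for i
      using Qd(2,3)[of 1] assms
      by (cases i; cases "i - 1") (simp_all add: coeff_pCons coeff_eq_0)
  qed
  have "ev [:b, 1:] = y + \<phi> b" for b
    by (simp add: ev_def hom_distribs)
  then have "ev (Q 1) = y + \<phi> (coeff (Q 1) 0)" by (subst Q1)
  moreover have "coeff (Q 1) 0 \<in> B" using Qd(1)[of 1] assms by (simp add: poly_over_def)
  ultimately show ?thesis using e unfolding e_def by auto
qed

end

section \<open>The fields of rational functions in f and in z\<close>

definition degree_fract :: "'a::field poly fract \<Rightarrow> int"
  where "degree_fract e = (THE d. \<exists>a b. a \<noteq> 0 \<and> b \<noteq> 0 \<and> e = Fract a b \<and>
    d = int (degree a) - int (degree b))"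

lemma degree_fract_Fract:
  assumes "a \<noteq> 0" "b \<noteq> 0"
  shows "degree_fract (Fract a b) = int (degree a) - int (degree b)"
  unfolding degree_fract_def
proof (rule the_equality)
  fix d
  assume "\<exists>a' b'. a' \<noteq> 0 \<and> b' \<noteq> 0 \<and> Fract a b = Fract a' b' \<and>
    d = int (degree a') - int (degree b')"
  then obtain a' b' where *: "a' \<noteq> 0" "b' \<noteq> 0" "a * b' = a' * b"
      "d = int (degree a') - int (degree b')"
    using assms by (auto simp: eq_fract)
  then have "degree a + degree b' = degree a' + degree b"
    using assms by (metis degree_mult_eq)
  then show "d = int (degree a) - int (degree b)" using *(4) by simp
qed (use assms in blast)

lemma degree_fract_to_fract: "degree_fract (to_fract h) = int (degree h)" if "h \<noteq> 0"
  using that degree_fract_Fract[of h 1] by (simp add: to_fract_def)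

interpretation degree_fract: valued_field "degree_fract :: 'a::field poly fract \<Rightarrow> int"
proof
  fix a b :: "'a poly fract"
  assume "a \<noteq> 0" "b \<noteq> 0"
  then obtain p q r s where a: "a = Fract p q" "p \<noteq> 0" "q \<noteq> 0" and b: "b = Fract r s" "r \<noteq> 0" "s \<noteq> 0"
    by (metis Fract_cases_nonzero)
  show "degree_fract (a * b) = degree_fract a + degree_fract b"
    using a b by (simp add: degree_fract_Fract degree_mult_eq)
  assume "a + b \<noteq> 0"
  have ab: "a + b = Fract (p * s + r * q) (q * s)" using a b by simp
  then have "p * s + r * q \<noteq> 0" using \<open>a + b \<noteq> 0\<close> by (auto simp: fract_collapse)
  moreover have "degree (p * s + r * q) \<le> max (degree p + degree s) (degree r + degree q)"
    using degree_add_le_max[of "p * s" "r * q"] a b by (simp add: degree_mult_eq)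
  ultimately show "degree_fract (a + b) \<le> max (degree_fract a) (degree_fract b)"
    unfolding ab using a b by (simp add: degree_fract_Fract degree_mult_eq)
qed

interpretation to_fract: inj_idom_hom "to_fract :: 'a::idom \<Rightarrow> 'a fract"
  by unfold_locales simp_all

definition compose_fract :: "'a::field poly \<Rightarrow> 'a poly fract \<Rightarrow> 'a poly fract"
  where "compose_fract f e = (THE w. \<exists>a b. b \<noteq> 0 \<and> e = Fract a b \<and> w = Fract (a \<circ>\<^sub>p f) (b \<circ>\<^sub>p f))"

context
  fixes f :: "'a::field poly"
  assumes f: "0 < degree f"
begin

lemma compose_nonzero: "b \<noteq> 0 \<Longrightarrow> b \<circ>\<^sub>p f \<noteq> 0"
  using f by (simp add: pcompose_eq_0_iff)

lemma compose_fract_Fract: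
  assumes "b \<noteq> 0"
  shows "compose_fract f (Fract a b) = Fract (a \<circ>\<^sub>p f) (b \<circ>\<^sub>p f)"
  unfolding compose_fract_def
proof (rule the_equality)
  fix w
  assume "\<exists>a' b'. b' \<noteq> 0 \<and> Fract a b = Fract a' b' \<and> w = Fract (a' \<circ>\<^sub>p f) (b' \<circ>\<^sub>p f)"
  then obtain a' b' where *: "b' \<noteq> 0" "a * b' = a' * b" "w = Fract (a' \<circ>\<^sub>p f) (b' \<circ>\<^sub>p f)"
    using assms by (auto simp: eq_fract)
  then have "(a \<circ>\<^sub>p f) * (b' \<circ>\<^sub>p f) = (a' \<circ>\<^sub>p f) * (b \<circ>\<^sub>p f)" by (metis pcompose_mult)
  then show "w = Fract (a \<circ>\<^sub>p f) (b \<circ>\<^sub>p f)"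
    using *(1,3) assms by (simp add: eq_fract compose_nonzero)
qed (use assms in blast)

lemma compose_fract_to_fract: "compose_fract f (to_fract a) = to_fract (a \<circ>\<^sub>p f)"
  by (simp add: to_fract_def compose_fract_Fract pcompose_1)

lemma compose_fract_hom: "field_hom (compose_fract f)"
proof
  show "compose_fract f 0 = 0" using compose_fract_to_fract[of 0] by simp
  show "compose_fract f 1 = 1" using compose_fract_to_fract[of 1] by (simp add: pcompose_1)
  fix x y :: "'a poly fract"
  obtain a b c d where x: "x = Fract a b" "b \<noteq> 0" and y: "y = Fract c d" "d \<noteq> 0"
    by (metis Fract_cases)
  show "compose_fract f (x + y) = compose_fract f x + compose_fract f y"
    using x y by (simp add: compose_fract_Fract compose_nonzero pcompose_add pcompose_mult)
  show "compose_fract f (x * y) = compose_fract f x * compose_fract f y"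
    using x y by (simp add: compose_fract_Fract pcompose_mult)
qed

lemma degree_compose_fract:
  assumes "a \<noteq> 0"
  shows "degree_fract (compose_fract f a) = int (degree f) * degree_fract a"
proof -
  obtain p q where "a = Fract p q" "p \<noteq> 0" "q \<noteq> 0" using assms by (metis Fract_cases_nonzero)
  then show ?thesis
    by (simp add: compose_fract_Fract degree_fract_Fract compose_nonzero degree_pcompose algebra_simps)
qed

lemma base_expansion: "\<exists>c. h = (\<Sum>k<degree f. (c k \<circ>\<^sub>p f) * [:0, 1:] ^ k)"
proof (induction "degree h" arbitrary: h rule: less_induct)
  case less
  define r where "r = h mod f"
  have "degree r < degree f" unfolding r_def using f by (rule degree_mod_monic_less)
  then have r: "r = (\<Sum>k<degree f. [:coeff r k:] * [:0, 1:] ^ k)"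
    using poly_as_sum_of_monoms'[of r "degree f - 1"] f
    by (cases "degree f") (simp_all add: lessThan_Suc_atMost monom_altdef)
  show ?case
  proof (cases "degree h < degree f")
    case True
    then have "h = r" by (simp add: r_def mod_poly_less)
    then show ?thesis using r by (intro exI[of _ "\<lambda>k. [:coeff r k:]"]) simp
  next
    case False
    then have "degree (h div f) < degree h" 
      using f degree_div_monic[OF f, of h] by (cases "h div f = 0") auto
    then obtain c where c: "h div f = (\<Sum>k<degree f. (c k \<circ>\<^sub>p f) * [:0, 1:] ^ k)"
      using less by blast
    have "h = f * (h div f) + r" unfolding r_def by (rule mult_div_mod_eq[symmetric])
    also have "\<dots> = (\<Sum>k<degree f. ((pCons (coeff r k) (c k)) \<circ>\<^sub>p f) * [:0, 1:] ^ k)"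
      unfolding c by (subst r)
        (simp add: sum_distrib_left sum.distrib[symmetric] pcompose_pCons algebra_simps)
    finally show ?thesis by (intro exI[of _ "\<lambda>k. pCons (coeff r k) (c k)"])
  qed
qed

text \<open>The characteristic polynomial of the multiplication by g on K[z], a free module over K[f] with basis
  1, z, ..., z^(n-1). It is evaluated over the fraction field, where roots are eigenvalues, and the basis
  itself is an eigenvector.\<close>

lemma integral_equation:
  fixes g :: "'a poly"
  shows "\<exists>P. lead_coeff P = 1 \<and> degree P = degree f \<and> poly (map_poly (\<lambda>a. a \<circ>\<^sub>p f) P) g = 0"
proof -
  define n where "n = degree f"
  define \<psi> where "\<psi> a = to_fract (a \<circ>\<^sub>p f)" for a
  interpret \<psi>: comm_ring_hom \<psi>
    by unfold_locales (simp_all add: \<psi>_def pcompose_add pcompose_mult pcompose_1)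
  have "\<exists>c. g * [:0, 1:] ^ i = (\<Sum>k<n. (c k \<circ>\<^sub>p f) * [:0, 1:] ^ k)" for i
    unfolding n_def by (rule base_expansion)
  then obtain c where c: "g * [:0, 1:] ^ i = (\<Sum>k<n. (c i k \<circ>\<^sub>p f) * [:0, 1:] ^ k)" for i
    by metis
  define M where "M = mat n n (\<lambda>(i, k). c i k)"
  have M: "M \<in> carrier_mat n n" by (simp add: M_def)
  define u where "u = vec n (\<lambda>k. to_fract ([:0, 1:] ^ k :: 'a poly))"
  have "eigenvector (map_mat \<psi> M) u (to_fract g)"
    unfolding eigenvector_def
  proof (intro conjI)
    show "u \<in> carrier_vec (dim_row (map_mat \<psi> M))" using M by (simp add: u_def)
    have "u $ 0 = 1" using f by (simp add: u_def n_def)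
    then show "u \<noteq> 0\<^sub>v (dim_row (map_mat \<psi> M))" using f M by (auto simp: n_def)
    show "map_mat \<psi> M *\<^sub>v u = to_fract g \<cdot>\<^sub>v u"
    proof (rule eq_vecI)
      fix i assume "i < dim_vec (to_fract g \<cdot>\<^sub>v u)"
      then have i: "i < n" by (simp add: u_def)
      have "(map_mat \<psi> M *\<^sub>v u) $ i = (\<Sum>k<n. to_fract ((c i k \<circ>\<^sub>p f) * [:0, 1:] ^ k))"
        using i by (simp add: M_def u_def scalar_prod_def \<psi>_def atLeast0LessThan)
      also have "\<dots> = to_fract (g * [:0, 1:] ^ i)" unfolding c by (simp add: to_fract.hom_sum)
      finally show "(map_mat \<psi> M *\<^sub>v u) $ i = (to_fract g \<cdot>\<^sub>v u) $ i"
        using i by (simp add: u_def)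
    qed (simp add: M_def u_def)
  qed
  then have "poly (char_poly (map_mat \<psi> M)) (to_fract g) = 0"
    using eigenvalue_root_char_poly[of "map_mat \<psi> M" n] M by (auto simp: eigenvalue_def)
  also have "char_poly (map_mat \<psi> M) = map_poly \<psi> (char_poly M)"
    by (rule \<psi>.char_poly_hom[OF M])
  also have "\<dots> = map_poly to_fract (map_poly (\<lambda>a. a \<circ>\<^sub>p f) (char_poly M))"
  proof -
    have "\<psi> = to_fract \<circ> (\<lambda>a. a \<circ>\<^sub>p f)" by (rule ext) (simp add: \<psi>_def)
    then show ?thesis by (simp add: map_poly_map_poly)
  qed
  also have "poly \<dots> (to_fract g) = to_fract (poly (map_poly (\<lambda>a. a \<circ>\<^sub>p f) (char_poly M)) g)"
    by (rule to_fract.poly_map_poly)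
  finally have "poly (map_poly (\<lambda>a. a \<circ>\<^sub>p f) (char_poly M)) g = 0" by simp
  then show ?thesis
    using degree_monic_char_poly[OF M] n_def by (intro exI[of _ "char_poly M"]) simp
qed

end

section \<open>The Abhyankar-Moh-Suzuki theorem\<close>

text \<open>The polynomials w for which w is the value at g of a polynomial over K[f] form a subalgebra containing
  f and g. This is where the hypothesis that f and g generate everything is used.\<close>

lemma degree_dvd_degree:
  fixes f g :: "'a::field_char_0 poly"
  assumes f: "0 < degree f" and le: "degree f \<le> degree g" and gen: "subalgebra_gen {f, g} = UNIV"
  shows "degree f dvd degree g"
proof (cases "degree f = 1")
  case False
  define n where "n = degree f"
  define \<phi> where "\<phi> = compose_fract f"
  define B where "B = range (to_fract :: 'a poly \<Rightarrow> _)"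
  define z where "z = to_fract ([:0, 1:] :: 'a poly)"
  define y where "y = to_fract g"
  have \<phi>_to_fract: "\<phi> (to_fract a) = to_fract (a \<circ>\<^sub>p f)" for a
    unfolding \<phi>_def by (rule compose_fract_to_fract[OF f])
  interpret \<phi>: field_hom \<phi> unfolding \<phi>_def by (rule compose_fract_hom[OF f])
  interpret mp: map_poly_idom_hom \<phi> ..
  interpret B: subring_of B
  proof
    show "1 \<in> B" unfolding B_def by (metis range_eqI to_fract_1)
    show "a - b \<in> B" "a * b \<in> B" if "a \<in> B" "b \<in> B" for a b
      using that unfolding B_def by (auto simp flip: to_fract_diff to_fract_mult)
  qed
  obtain P0 where P0: "lead_coeff P0 = 1" "degree P0 = n"
      "poly (map_poly (\<lambda>a. a \<circ>\<^sub>p f) P0) g = 0"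
    using integral_equation[OF f, of g] n_def by blast
  define P where "P = map_poly to_fract P0"
  have P: "poly_over B P" "lead_coeff P = 1" "degree P = n"
    using P0 by (auto simp: P_def poly_over_def B_def)
  have "map_poly \<phi> P = map_poly to_fract (map_poly (\<lambda>a. a \<circ>\<^sub>p f) P0)"
    unfolding P_def by (simp add: map_poly_map_poly comp_def \<phi>_to_fract)
  then have evP: "poly (map_poly \<phi> P) y = 0"
    using P0(3) by (simp add: y_def)
  define A where "A = {w. \<exists>W. poly_over B W \<and> poly (map_poly \<phi> W) y = to_fract w}"
  have const: "to_fract (a \<circ>\<^sub>p f) = poly (map_poly \<phi> [:to_fract a:]) y" for a
    by (simp add: \<phi>.map_poly_pCons_hom \<phi>_to_fract)
  have constB: "poly_over B [:to_fract a:]" for a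
    using B.poly_over_monom[of "to_fract a" 0] by (simp add: monom_0 B_def)
  have "is_subalgebra A"
    unfolding is_subalgebra_def
  proof (intro conjI ballI allI)
    show "1 \<in> A" unfolding A_def using B.poly_over_1 by (auto intro!: exI[of _ 1])
    fix p q
    assume "p \<in> A" "q \<in> A"
    then obtain V W where V: "poly_over B V" "poly (map_poly \<phi> V) y = to_fract p"
        and W: "poly_over B W" "poly (map_poly \<phi> W) y = to_fract q"
      by (auto simp: A_def)
    show "p + q \<in> A"
      unfolding A_def using B.poly_over_add[OF V(1) W(1)] V(2) W(2)
      by (auto intro!: exI[of _ "V + W"] simp: mp.hom_add)
    show "p * q \<in> A"
      unfolding A_def using B.poly_over_mult[OF V(1) W(1)] V(2) W(2)
      by (auto intro!: exI[of _ "V * W"] simp: mp.hom_mult)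
  next
    show "smult a p \<in> A" if p: "p \<in> A" for a p
    proof -
      obtain W where W: "poly_over B W" "poly (map_poly \<phi> W) y = to_fract p"
        using p by (auto simp: A_def)
      have "poly (map_poly \<phi> (smult (to_fract [:a:]) W)) y = to_fract ([:a:] * p)"
        by (simp only: \<phi>.map_poly_hom_smult to_fract_mult poly_smult W(2) \<phi>_to_fract pcompose_const)
      moreover have "poly_over B (smult (to_fract [:a:]) W)"
        using W(1) by (intro B.poly_over_smult) (simp_all add: B_def)
      moreover have "smult a p = [:a:] * p" by simp
      ultimately show ?thesis unfolding A_def mem_Collect_eq by metis
    qed
  qed
  moreover have "f \<in> A"
    unfolding A_def using constB[of "[:0, 1:]"] const[of "[:0, 1:]"] by (auto simp: pcompose_idR pcompose_pCons)
  moreover have "g \<in> A"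
    unfolding A_def using B.poly_over_monom[OF B.B_1, of 1]
    by (auto intro!: exI[of _ "monom 1 1"] simp: y_def poly_monom)
  ultimately have "A = UNIV"
    using subalgebra_gen_minimal[of "{f, g}" A] gen by auto
  then have generated: "\<exists>W. poly_over B W \<and> poly (map_poly \<phi> W) y = to_fract w" for w
    by (auto simp: A_def)
  interpret valued_extension \<phi> degree_fract n z y
  proof
    show "0 < n" using f n_def by simp
    show "int n dvd degree_fract (\<phi> a)" if "a \<noteq> 0" for a
      unfolding \<phi>_def degree_compose_fract[OF f that] n_def by simp
    show "z \<noteq> 0" "degree_fract z = 1"
      by (simp_all add: z_def degree_fract_to_fract)
    show "\<exists>c. y ^ j = (\<Sum>k<n. \<phi> (c k) * z ^ k)" for j
    proof -
      obtain c where "g ^ j = (\<Sum>k<n. (c k \<circ>\<^sub>p f) * [:0, 1:] ^ k)"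
        unfolding n_def using base_expansion[OF f, of "g ^ j"] by blast
      then have "to_fract (g ^ j) = to_fract (\<Sum>k<n. (c k \<circ>\<^sub>p f) * [:0, 1:] ^ k)"
        by (rule arg_cong)
      then have "y ^ j = (\<Sum>k<n. \<phi> (to_fract (c k)) * z ^ k)"
        unfolding y_def z_def \<phi>_to_fract by (simp only: to_fract.hom_power to_fract_mult to_fract.hom_sum)
      then show ?thesis by (rule exI[of _ "\<lambda>k. to_fract (c k)"])
    qed
    show "\<exists>c. z ^ k = (\<Sum>j<n. \<phi> (c j) * y ^ j)" for k
    proof -
      obtain W where W: "poly (map_poly \<phi> W) y = z ^ k"
        using generated[of "[:0, 1:] ^ k"] by (auto simp: z_def to_fract.hom_power)
      define R where "R = W mod P"
      have "poly (map_poly \<phi> W) y = poly (map_poly \<phi> (W div P * P + R)) y" by (simp add: R_def)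
      also have "\<dots> = poly (map_poly \<phi> R) y"
        by (simp only: mp.hom_add mp.hom_mult poly_add poly_mult evP mult_zero_right add_0)
      finally have "poly (map_poly \<phi> W) y = poly (map_poly \<phi> R) y" .
      moreover have "degree R < n"
        unfolding R_def using degree_mod_monic_less[of P W] P(3) f n_def by simp
      then have "map_poly \<phi> R = (\<Sum>j<n. monom (\<phi> (coeff R j)) j)"
        using poly_as_sum_of_monoms'[of "map_poly \<phi> R" "n - 1"]
        by (cases n) (simp_all add: lessThan_Suc_atMost)
      ultimately have "z ^ k = (\<Sum>j<n. \<phi> (coeff R j) * y ^ j)"
        using W by (simp add: poly_sum poly_monom)
      then show ?thesis by (rule exI[of _ "coeff R"])
    qed
  qed
  interpret integral_extension \<phi> degree_fract n z y B P
  proof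
    have of_nat: "of_nat k = to_fract (of_nat k :: 'a poly)" for k
      by (simp add: to_fract.hom_of_nat)
    show "of_nat k \<noteq> (0 :: 'a poly fract)" if "0 < k" for k
      using that unfolding of_nat by (simp del: to_fract.hom_of_nat)
    show "1 / of_nat k \<in> B" if "0 < k" for k
    proof -
      have "of_nat k * [:1 / of_nat k:] = (1 :: 'a poly)"
        using that by (simp add: of_nat_poly one_pCons)
      then have "of_nat k * to_fract [:1 / of_nat k:] = (1 :: 'a poly fract)"
        unfolding of_nat by (metis to_fract_1 to_fract_mult)
      then have "1 / of_nat k = to_fract [:1 / of_nat k :: 'a:]"
        using nonzero_eq_divide_eq[of "of_nat k :: 'a poly fract"] by (metis mult.commute mult_zero_left zero_neq_one)
      then show ?thesis by (simp add: B_def)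
    qed
    show "0 \<le> degree_fract (\<phi> a)" if a: "a \<in> B" "a \<noteq> 0" for a
    proof -
      obtain h where "a = to_fract h" "h \<noteq> 0" using a by (auto simp: B_def)
      then show ?thesis
        using degree_compose_fract[OF f a(2)] by (simp add: \<phi>_def degree_fract_to_fract)
    qed
    show "poly_over B P" "lead_coeff P = 1" "degree P = n" "ev P = 0"
      using P evP by (simp_all add: ev_def)
    show "\<exists>W. poly_over B W \<and> ev W = z ^ k" for k
      using generated[of "[:0, 1:] ^ k"] by (simp add: ev_def z_def to_fract.hom_power)
  qed
  obtain a where "degree_fract (y + \<phi> (to_fract a)) < int n"
    using y_reduces_below_n f False n_def B_def by auto
  then have small: "degree_fract (to_fract (g + a \<circ>\<^sub>p f)) < int n"
    by (simp add: y_def \<phi>_to_fract)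
  have "degree (g + a \<circ>\<^sub>p f) < n"
    using small degree_fract_to_fract[of "g + a \<circ>\<^sub>p f"] f n_def by (cases "g + a \<circ>\<^sub>p f = 0") auto
  then have "degree (g + a \<circ>\<^sub>p f) < degree g" using le n_def by simp
  moreover have "a \<circ>\<^sub>p f = (g + a \<circ>\<^sub>p f) - g" by simp
  ultimately have "degree (a \<circ>\<^sub>p f) = degree g"
    by (metis degree_add_eq_right degree_minus diff_conv_add_uminus)
  then show ?thesis by (metis degree_pcompose dvd_triv_right)
qed simp

theorem mainTheorem1:
  fixes f g :: "'a::field_char_0 poly" and n m :: nat
  assumes "degree f = n" and "degree g = m"
    and "subalgebra_gen {f, g} = UNIV"
  shows "n dvd m \<or> m dvd n"
proof (cases "n = 0 \<or> m = 0")
  case False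
  then show ?thesis
    using degree_dvd_degree[of f g] degree_dvd_degree[of g f] assms
    by (metis insert_commute linorder_le_cases neq0_conv)
qed auto

end
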